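(* Let $(\Sigma,m)$ be a weighted simplicial complex. If $\rho\in\Sigma$ and all connected components of the graph $b_\rho$ over $\mathrm{lk}(\rho)$ are recurrent, then $$\delta_D1_\rho\in D(\delta_D).$$ In particular, $\delta_D1_\rho$ is a harmonic eigenfunction of $\Delta^+_D$ (that is, $\delta_D 1_\rho\neq 0$, $\delta_D1_\rho\in D(\Delta_D^+)$ and $\Delta^+_D\delta_D1_\rho=0$) whenever $\rho$ has a coface.
   Context: Weighted simplicial complexes. Let $X$ be a set (of vertices). A simplicial complex $\hat\Sigma$ over $X$ is a (non-empty) set of finite subsets of $X$ closed under taking subsets, whose $0$-simplices are identified with $X$; it contains $\varnothing$. A simplex with $k+1$ elements has dimension $k$. Write $\tau\prec\sigma$ (or $\sigma\succ\tau$) if $\tau\subseteq\sigma$ and $|\sigma\setminus\tau|=1$; then $\tau$ is a face of $\sigma$ and $\sigma$ a coface of $\tau$. Let $m:\hat\Sigma\to(0,\infty)$. Put $\Sigma=\hat\Sigma$ if $\sum_{x\in X}m(x)<\infty$ and $\Sigma=\hat\Sigma\setminus\{\varnothing\}$ otherwise. Assume $m$ is locally summable: $\sum_{\sigma\succ\tau}m(\sigma)<\infty$ for all $\tau\in\Sigma$. Then $(\Sigma,m)$ is called a weighted simplicial complex; no local finiteness is assumed. All simplices below range over $\Sigma$. $C(\Sigma)$ denotes the complex functions on $\Sigma$, $C_c(\Sigma)$ those of finite support, $1_\rho$ is the characteristic function of $\rho\in\Sigma$, and $\ell^2=\ell^2(\Sigma,m)$ is the Hilbert space with inner product $\langle f,g\rangle=\sum_{\tau\in\Sigma}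 m(\tau)f(\tau)\overline{g(\tau)}$ and norm $\|\cdot\|_2$. Coboundary. Fix a coboundary operator, i.e. a linear operator $\delta:C(\Sigma)\to C(\Sigma)$ of the form $\delta\omega(\sigma)=\sum_{\tau\prec\sigma}\theta(\tau,\sigma)\omega(\tau)$ (a finite sum) with $\theta(\tau,\sigma)=\delta 1_\tau(\sigma)\in\{\pm1\}$ for $\tau\prec\sigma$, satisfying $\delta\delta=0$. Local summability gives $\delta C_c(\Sigma)\subseteq\ell^2$. $\delta_D$ is the restriction of $\delta$ to $D(\delta_D)=\{\omega\in\ell^2:\lim_n(\|\omega_n-\omega\|_2^2+\|\delta(\omega_n-\omega)\|_2^2)=0\text{ for some }\omega_n\in C_c(\Sigma)\}$, a closed densely defined operator on $\ell^2$. The up-Laplacian with Dirichlet boundary conditions $\Delta^+_D$ is the positive self-adjoint operator on $\ell^2$ associated to the closed quadratic form $Q^+_D(\omega)=\|\delta\omega\|_2^2$ with domain $D(Q^+_D)=D(\delta_D)$; equivalently $\Delta^+_D=\delta_D^*\delta_D=\partial_N\delta_D$, where $\partial_N$ is the restriction of $\partial\omega(\tau)=\frac1{m(\tau)}\sum_{\sigma\succ\tau}m(\sigma)\theta(\tau,\sigma)\omega(\sigma)$ to $\{\omega\in\ell^2:\partial\omega\in\ell^2\}$. Links. For $\rho\in\Sigma$, $\mathrm{lk}(\rho)=\{v\in X: v\cup\rho\in\Sigma,\ v\cup\rho\succ\rho\}$ (identifying the vertex $v$ with $\{v\}$), with $v\rho=v\cup\rho$ and $vv'\rho=v\cup v'\cup\rho$.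 The link graph is the symmetric function $b_\rho:\mathrm{lk}(\rho)\times\mathrm{lk}(\rho)\to[0,\infty)$, $b_\rho(v,v')=m(vv'\rho)$ if $v\ne v'$ and $vv'\rho\in\Sigma$, and $b_\rho(v,v')=0$ otherwise. Local summability gives $\sum_{v'}b_\rho(v,v')<\infty$ for all $v\in\mathrm{lk}(\rho)$. Connected components are the classes of vertices joined by finite paths along which $b_\rho>0$. Recurrence. A connected graph $b$ over $X$ is recurrent if the Markov chain $(Y_n)$ with transition probabilities $\mathbb P(Y_n=y\mid Y_{n-1}=x)=b(x,y)/\sum_z b(x,z)$ satisfies $\mathbb P(Y_k=y\text{ for some }k>0\mid Y_0=x)=1$ for all $x,y$; equivalently, the constant function $1$ is a pointwise limit of finitely supported functions $\varphi_n$ with $\frac12\sum_{x,y}b(x,y)|\varphi_n(x)-\varphi_n(y)|^2\to0$. A component consisting of a single vertex counts as recurrent. *)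

theory Defs
  imports "HOL-Probability.Probability"
begin

section \<open>Weighted simplicial complexes\<close>

definition face :: "'a set \<Rightarrow> 'a set \<Rightarrow> bool" where
  "face \<tau> \<sigma> \<longleftrightarrow> \<tau> \<subseteq> \<sigma> \<and> card (\<sigma> - \<tau>) = 1"

definition simplicial_complex :: "'a set \<Rightarrow> 'a set set \<Rightarrow> bool" where
  "simplicial_complex X K \<longleftrightarrow>
     K \<noteq> {} \<and>
     (\<forall>\<sigma>\<in>K. finite \<sigma> \<and> \<sigma> \<subseteq> X) \<and>
     (\<forall>\<sigma>\<in>K. \<forall>\<tau>. \<tau> \<subseteq> \<sigma> \<longrightarrow> \<tau> \<in> K) \<and>
     (\<forall>x\<in>X. {x} \<in> K)"

text \<open>The empty simplex is kept exactly when the total mass of the vertices is finite.\<close>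

definition simplices :: "'a set \<Rightarrow> 'a set set \<Rightarrow> ('a set \<Rightarrow> real) \<Rightarrow> 'a set set" where
  "simplices X K m = (if (\<lambda>x. m {x}) summable_on X then K else K - {{}})"

definition weighted_simplicial_complex ::
    "'a set \<Rightarrow> 'a set set \<Rightarrow> ('a set \<Rightarrow> real) \<Rightarrow> bool" where
  "weighted_simplicial_complex X K m \<longleftrightarrow>
     simplicial_complex X K \<and>
     (\<forall>\<sigma>\<in>K. 0 < m \<sigma>) \<and>
     (\<forall>\<tau>\<in>simplices X K m. m summable_on {\<sigma> \<in> simplices X K m. face \<tau> \<sigma>})"

section \<open>Function spaces\<close>

text \<open>A function on \<open>S\<close> is encoded as a function on the whole type that vanishes outside \<open>S\<close>,
  so that equality of such functions is equality in HOL.\<close>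

definition fun_space :: "'b set \<Rightarrow> ('b \<Rightarrow> complex) set" where
  "fun_space S = {f. \<forall>\<tau>. \<tau> \<notin> S \<longrightarrow> f \<tau> = 0}"

definition fin_supp :: "'b set \<Rightarrow> ('b \<Rightarrow> complex) set" where
  "fin_supp S = {f \<in> fun_space S. finite {\<tau>. f \<tau> \<noteq> 0}}"

text \<open>The squared norm takes values in \<^typ>\<open>ennreal\<close>: a real-valued infinite sum would be \<open>0\<close>
  for functions that are not square summable.\<close>

definition sqnorm :: "'b set \<Rightarrow> ('b \<Rightarrow> real) \<Rightarrow> ('b \<Rightarrow> complex) \<Rightarrow> ennreal" where
  "sqnorm S m f = (\<Sum>\<^sub>\<infinity>\<tau>\<in>S. ennreal (m \<tau> * (cmod (f \<tau>))\<^sup>2))"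

definition ell2 :: "'b set \<Rightarrow> ('b \<Rightarrow> real) \<Rightarrow> ('b \<Rightarrow> complex) set" where
  "ell2 S m = {f \<in> fun_space S. sqnorm S m f < \<infinity>}"

definition ell2_inner ::
    "'b set \<Rightarrow> ('b \<Rightarrow> real) \<Rightarrow> ('b \<Rightarrow> complex) \<Rightarrow> ('b \<Rightarrow> complex) \<Rightarrow> complex" where
  "ell2_inner S m f g = (\<Sum>\<^sub>\<infinity>\<tau>\<in>S. of_real (m \<tau>) * f \<tau> * cnj (g \<tau>))"

section \<open>Coboundary operator and up-Laplacian with Dirichlet boundary conditions\<close>

text \<open>The signs are \<open>\<theta>(\<tau>, \<sigma>) = \<delta> 1\<^sub>\<tau>(\<sigma>)\<close>; linearity of \<open>\<delta>\<close> on the functions on \<open>S\<close> follows from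
  the formula.\<close>

definition coboundary_operator ::
    "'a set set \<Rightarrow> (('a set \<Rightarrow> complex) \<Rightarrow> ('a set \<Rightarrow> complex)) \<Rightarrow> bool" where
  "coboundary_operator S \<delta> \<longleftrightarrow>
     (\<forall>\<sigma>\<in>S. \<forall>\<tau>\<in>S. face \<tau> \<sigma> \<longrightarrow> \<delta> (indicator {\<tau>}) \<sigma> \<in> {1, -1}) \<and>
     (\<forall>\<omega>\<in>fun_space S. \<delta> \<omega> =
        (\<lambda>\<sigma>. if \<sigma> \<in> S then (\<Sum>\<tau> | \<tau> \<in> S \<and> face \<tau> \<sigma>. \<delta> (indicator {\<tau>}) \<sigma> * \<omega> \<tau>) else 0)) \<and>
     (\<forall>\<omega>\<in>fun_space S. \<delta> (\<delta> \<omega>) = (\<lambda>_. 0))"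

definition dom_cobd_D ::
    "'a set set \<Rightarrow> ('a set \<Rightarrow> real) \<Rightarrow> (('a set \<Rightarrow> complex) \<Rightarrow> ('a set \<Rightarrow> complex)) \<Rightarrow>
      ('a set \<Rightarrow> complex) set" where
  "dom_cobd_D S m \<delta> = {\<omega> \<in> ell2 S m. \<exists>\<omega>n :: nat \<Rightarrow> 'a set \<Rightarrow> complex.
      (\<forall>n. \<omega>n n \<in> fin_supp S) \<and>
      (\<lambda>n. sqnorm S m (\<lambda>\<tau>. \<omega>n n \<tau> - \<omega> \<tau>) + sqnorm S m (\<delta> (\<lambda>\<tau>. \<omega>n n \<tau> - \<omega> \<tau>)))
        \<longlonglongrightarrow> 0}"

definition cobd_D ::
    "'a set set \<Rightarrow> ('a set \<Rightarrow> real) \<Rightarrow> (('a set \<Rightarrow> complex) \<Rightarrow> ('a set \<Rightarrow> complex)) \<Rightarrow>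
      ('a set \<Rightarrow> complex) \<Rightarrow> ('a set \<Rightarrow> complex)" where
  "cobd_D S m \<delta> = restrict \<delta> (dom_cobd_D S m \<delta>)"

text \<open>The sesquilinear form, with domain \<^term>\<open>dom_cobd_D S m \<delta>\<close>, obtained by polarization from
  \<open>Q(\<omega>) = \<parallel>\<delta>\<omega>\<parallel>\<^sup>2\<close>.\<close>

definition form_D ::
    "'a set set \<Rightarrow> ('a set \<Rightarrow> real) \<Rightarrow> (('a set \<Rightarrow> complex) \<Rightarrow> ('a set \<Rightarrow> complex)) \<Rightarrow>
      ('a set \<Rightarrow> complex) \<Rightarrow> ('a set \<Rightarrow> complex) \<Rightarrow> complex" where
  "form_D S m \<delta> \<omega> \<phi> = ell2_inner S m (cobd_D S m \<delta> \<omega>) (cobd_D S m \<delta> \<phi>)"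

text \<open>The operator \<open>\<Delta>\<close> associated to a closed form \<open>Q\<close>: \<open>\<omega> \<in> D(\<Delta>)\<close> with \<open>\<Delta>\<omega> = \<eta>\<close> iff
  \<open>\<omega> \<in> D(Q)\<close>, \<open>\<eta> \<in> \<ell>\<^sup>2\<close> and \<open>Q(\<omega>, \<phi>) = \<langle>\<eta>, \<phi>\<rangle>\<close> for all \<open>\<phi> \<in> D(Q)\<close>.\<close>

definition represents_form_D ::
    "'a set set \<Rightarrow> ('a set \<Rightarrow> real) \<Rightarrow> (('a set \<Rightarrow> complex) \<Rightarrow> ('a set \<Rightarrow> complex)) \<Rightarrow>
      ('a set \<Rightarrow> complex) \<Rightarrow> ('a set \<Rightarrow> complex) \<Rightarrow> bool" where
  "represents_form_D S m \<delta> \<omega> \<eta> \<longleftrightarrow>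
     \<eta> \<in> ell2 S m \<and> (\<forall>\<phi>\<in>dom_cobd_D S m \<delta>. form_D S m \<delta> \<omega> \<phi> = ell2_inner S m \<eta> \<phi>)"

definition dom_up_laplacian_D ::
    "'a set set \<Rightarrow> ('a set \<Rightarrow> real) \<Rightarrow> (('a set \<Rightarrow> complex) \<Rightarrow> ('a set \<Rightarrow> complex)) \<Rightarrow>
      ('a set \<Rightarrow> complex) set" where
  "dom_up_laplacian_D S m \<delta> = {\<omega> \<in> dom_cobd_D S m \<delta>. \<exists>\<eta>. represents_form_D S m \<delta> \<omega> \<eta>}"

definition up_laplacian_D ::
    "'a set set \<Rightarrow> ('a set \<Rightarrow> real) \<Rightarrow> (('a set \<Rightarrow> complex) \<Rightarrow> ('a set \<Rightarrow> complex)) \<Rightarrow>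
      ('a set \<Rightarrow> complex) \<Rightarrow> ('a set \<Rightarrow> complex)" where
  "up_laplacian_D S m \<delta> =
     (\<lambda>\<omega>\<in>dom_up_laplacian_D S m \<delta>. THE \<eta>. represents_form_D S m \<delta> \<omega> \<eta>)"

lemma indicator_in_dom_cobd_D:
  assumes "coboundary_operator S \<delta>" and "\<rho> \<in> S"
  shows "indicator {\<rho>} \<in> dom_cobd_D S m \<delta>"
proof -
  let ?f = "indicator {\<rho>} :: 'a set \<Rightarrow> complex"
  have fs: "?f \<in> fin_supp S"
    using assms(2) by (auto simp: fin_supp_def fun_space_def indicator_def)
  have "sqnorm S m ?f = (\<Sum>\<^sub>\<infinity>\<tau>\<in>{\<rho>}. ennreal (m \<tau> * (cmod (?f \<tau>))\<^sup>2))"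
    unfolding sqnorm_def using assms(2) by (intro infsum_cong_neutral) auto
  then have e: "?f \<in> ell2 S m"
    using fs by (simp add: ell2_def fin_supp_def)
  have z: "sqnorm S m (\<lambda>_. 0) = 0" by (simp add: sqnorm_def)
  have "(\<lambda>_. 0) \<in> fun_space S" by (simp add: fun_space_def)
  then have "\<delta> (\<lambda>_. 0) = (\<lambda>_. 0)"
    using assms(1) unfolding coboundary_operator_def by fastforce
  then show ?thesis
    using e fs z unfolding dom_cobd_D_def by (auto intro!: exI[of _ "\<lambda>_. ?f"])
qed

text \<open>The description in \<^const>\<open>up_laplacian_D\<close> is unambiguous.\<close>

lemma represents_form_D_unique:
  assumes \<delta>: "coboundary_operator S \<delta>" and m: "\<And>\<tau>. \<tau> \<in> S \<Longrightarrow> 0 < m \<tau>"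
    and 1: "represents_form_D S m \<delta> \<omega> \<eta>" and 2: "represents_form_D S m \<delta> \<omega> \<eta>'"
  shows "\<eta> = \<eta>'"
proof
  fix \<tau>
  show "\<eta> \<tau> = \<eta>' \<tau>"
  proof (cases "\<tau> \<in> S")
    case True
    have *: "ell2_inner S m f (indicator {\<tau>}) = of_real (m \<tau>) * f \<tau>" for f
    proof -
      have "ell2_inner S m f (indicator {\<tau>})
          = (\<Sum>\<^sub>\<infinity>\<sigma>\<in>{\<tau>}. of_real (m \<sigma>) * f \<sigma> * cnj (indicator {\<tau>} \<sigma>))"
        unfolding ell2_inner_def using True by (intro infsum_cong_neutral) auto
      then show ?thesis by simp
    qed
    have "ell2_inner S m \<eta> (indicator {\<tau>}) = ell2_inner S m \<eta>' (indicator {\<tau>})"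
      using 1 2 indicator_in_dom_cobd_D[OF \<delta> True] unfolding represents_form_D_def by metis
    then show ?thesis using m[OF True] by (simp add: *)
  next
    case False
    then show ?thesis
      using 1 2 by (simp add: represents_form_D_def ell2_def fun_space_def)
  qed
qed

section \<open>Recurrence of graphs\<close>

text \<open>\<open>Y\<close> is a Markov chain on the state space \<open>V\<close> with transition probabilities \<open>p\<close> that starts
  in \<open>x\<close>, expressed by its finite-dimensional distributions.\<close>

definition markov_chain ::
    "'w measure \<Rightarrow> (nat \<Rightarrow> 'w \<Rightarrow> 'v) \<Rightarrow> 'v set \<Rightarrow> ('v \<Rightarrow> 'v \<Rightarrow> real) \<Rightarrow> 'v \<Rightarrow> bool" where
  "markov_chain M Y V p x \<longleftrightarrow>
     prob_space M \<and> (\<forall>n. Y n \<in> measurable M (count_space V)) \<and>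
     (\<forall>n s. (\<forall>i\<le>n. s i \<in> V) \<longrightarrow>
        measure M {\<omega> \<in> space M. \<forall>i\<le>n. Y i \<omega> = s i} =
          (if s 0 = x then 1 else 0) * (\<Prod>i<n. p (s i) (s (Suc i))))"

text \<open>The chain is realized as the coordinate process on the path space; its law there exists
  (Ionescu-Tulcea) and is determined by \<^const>\<open>markov_chain\<close> on the events below, so the
  existential quantifier over \<open>M\<close> merely names it.\<close>

definition recurrent_graph :: "'v set \<Rightarrow> ('v \<Rightarrow> 'v \<Rightarrow> real) \<Rightarrow> bool" where
  "recurrent_graph V b \<longleftrightarrow>
     (\<forall>x\<in>V. \<forall>y\<in>V. \<exists>M :: (nat \<Rightarrow> 'v) measure.
        markov_chain M (\<lambda>k \<omega>. \<omega> k) V (\<lambda>u w. b u w / (\<Sum>\<^sub>\<infinity>z\<in>V. b u z)) x \<and>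
        measure M {\<omega> \<in> space M. \<exists>k>0. \<omega> k = y} = 1)"

definition graph_components :: "'v set \<Rightarrow> ('v \<Rightarrow> 'v \<Rightarrow> real) \<Rightarrow> 'v set set" where
  "graph_components V b =
     V // {(u, w). u \<in> V \<and> w \<in> V \<and> (\<lambda>u w. u \<in> V \<and> w \<in> V \<and> b u w > 0)\<^sup>*\<^sup>* u w}"

text \<open>On a single vertex without loop there is no Markov chain; by convention such a component
  is recurrent.\<close>

definition recurrent_component :: "'v set \<Rightarrow> ('v \<Rightarrow> 'v \<Rightarrow> real) \<Rightarrow> bool" where
  "recurrent_component C b \<longleftrightarrow> is_singleton C \<or> recurrent_graph C b"

section \<open>Links\<close>

definition link :: "'a set \<Rightarrow> 'a set set \<Rightarrow> 'a set \<Rightarrow> 'a set" where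
  "link X S \<rho> = {v \<in> X. {v} \<union> \<rho> \<in> S \<and> face \<rho> ({v} \<union> \<rho>)}"

definition link_graph :: "'a set set \<Rightarrow> ('a set \<Rightarrow> real) \<Rightarrow> 'a set \<Rightarrow> 'a \<Rightarrow> 'a \<Rightarrow> real" where
  "link_graph S m \<rho> v v' =
     (if v \<noteq> v' \<and> {v} \<union> {v'} \<union> \<rho> \<in> S then m ({v} \<union> {v'} \<union> \<rho>) else 0)"

end

theory Submission
  imports Defs
begin

text \<open>Write \<open>\<eta> = \<delta>1\<^sub>\<rho>\<close>. It takes the values \<open>\<plusminus>1\<close> on the cofaces \<open>v\<rho>\<close> of \<open>\<rho>\<close> and vanishes elsewhere, so
  local summability at \<open>\<rho>\<close> puts it in \<open>\<ell>\<^sup>2\<close>, and \<open>\<delta>\<eta> = 0\<close>. What has to be shown is that \<open>\<eta>\<close> is a limit of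
  finitely supported functions in the graph norm of \<open>\<delta>\<close>; harmonicity is then immediate, since the
  form \<open>\<langle>\<delta>\<eta>, \<delta>\<phi>\<rangle>\<close> is zero for every \<open>\<phi>\<close> in its domain.

  For a function \<open>\<phi>\<close> on the link put \<open>\<omega>(v\<rho>) = \<phi>(v) \<eta>(v\<rho>)\<close>. A simplex on which \<open>\<delta>\<omega>\<close> does not vanish
  is of the form \<open>vw\<rho>\<close>; between it and \<open>\<rho>\<close> lie only \<open>v\<rho>\<close> and \<open>w\<rho>\<close>, and \<open>\<delta>\<eta>(vw\<rho>) = 0\<close> forces opposite
  signs, whence \<open>\<bar>\<delta>\<omega>(vw\<rho>)\<bar> = \<bar>\<phi>(v) - \<phi>(w)\<bar>\<close> (\<open>coboundary_truncation\<close>). Thus \<open>\<parallel>\<delta>\<omega>\<parallel>\<^sup>2\<close> is at most the energy of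
  \<open>\<phi>\<close> on the link graph, while \<open>\<parallel>\<omega> - \<eta>\<parallel>\<^sup>2\<close> is at most the mass of the cofaces \<open>v\<rho>\<close> with \<open>\<phi>(v) \<noteq> 1\<close> as
  soon as \<open>0 \<le> \<phi> \<le> 1\<close>. It remains to find, for each finite set of vertices of the link, finitely
  supported \<open>\<phi>\<close> with values in \<open>[0, 1]\<close> that equal \<open>1\<close> on this set and have arbitrarily small energy.

  Since the energy of a maximum is at most the sum of the energies, it is enough to do this for a
  single vertex \<open>x\<close>. There \<open>\<phi>(y)\<close> is the probability that the chain started in \<open>y\<close> hits \<open>x\<close> within \<open>n\<close>
  steps and without leaving a finite set \<open>A\<close>. Off \<open>x\<close> this function is subharmonic, because it grows
  with \<open>n\<close>, so summation by parts bounds its energy by twice the degree of \<open>x\<close> times the probability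
  of not returning to \<open>x\<close> inside \<open>A\<close> within \<open>n + 1\<close> steps (\<open>energy_hit_prob\<close>). Recurrence
  makes this probability tend to \<open>0\<close> as \<open>A\<close> and \<open>n\<close> grow (\<open>recurrent_return_prob\<close>).\<close>

section \<open>Energy and capacity\<close>

text \<open>The sum runs over ordered pairs, so \<open>e\<close> bounds twice the usual Dirichlet energy. Bounding
  all finite partial sums is the same as bounding the infinite sum, without a side condition on
  summability.\<close>

definition energy_le :: "'v set \<Rightarrow> ('v \<Rightarrow> 'v \<Rightarrow> real) \<Rightarrow> ('v \<Rightarrow> real) \<Rightarrow> real \<Rightarrow> bool" where
  "energy_le V b \<phi> e \<longleftrightarrow>
     (\<forall>W. finite W \<longrightarrow> W \<subseteq> V \<longrightarrow> (\<Sum>u\<in>W. \<Sum>w\<in>W. b u w * (\<phi> u - \<phi> w)\<^sup>2) \<le> e)"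

text \<open>These are the finite sets that have capacity zero relative to infinity: test functions are
  finitely supported, and truncating them to \<open>[0, 1]\<close> costs no generality.\<close>

definition zero_capacity :: "'v set \<Rightarrow> ('v \<Rightarrow> 'v \<Rightarrow> real) \<Rightarrow> 'v set \<Rightarrow> bool" where
  "zero_capacity V b F \<longleftrightarrow>
     (\<forall>e>0. \<exists>\<phi>. finite {v. \<phi> v \<noteq> 0} \<and> {v. \<phi> v \<noteq> 0} \<subseteq> V \<and> (\<forall>v. 0 \<le> \<phi> v \<and> \<phi> v \<le> 1) \<and>
        (\<forall>x\<in>F. \<phi> x = 1) \<and> energy_le V b \<phi> e)"

lemma energy_le_mono: "energy_le V b \<phi> d \<Longrightarrow> d \<le> e \<Longrightarrow> energy_le V b \<phi> e"
  unfolding energy_le_def by (meson order_trans)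

text \<open>Taking maxima is \<open>1\<close>-Lipschitz for the supremum norm on \<open>\<real>\<^sup>2\<close>, which is dominated by the
  Euclidean norm. This is what makes capacity subadditive.\<close>

lemma energy_le_max:
  assumes b: "\<And>u w. u \<in> V \<Longrightarrow> w \<in> V \<Longrightarrow> 0 \<le> b u w"
    and 1: "energy_le V b \<phi> d" and 2: "energy_le V b \<psi> e"
  shows "energy_le V b (\<lambda>v. max (\<phi> v) (\<psi> v)) (d + e)"
  unfolding energy_le_def
proof (intro allI impI)
  fix W assume W: "finite W" "W \<subseteq> V"
  have sq: "(max a c - max a' c')\<^sup>2 \<le> (a - a')\<^sup>2 + (c - c')\<^sup>2" for a a' c c' :: real
  proof -
    have "\<bar>max a c - max a' c'\<bar> \<le> max \<bar>a - a'\<bar> \<bar>c - c'\<bar>" by linarith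
    then have "(max a c - max a' c')\<^sup>2 \<le> (max \<bar>a - a'\<bar> \<bar>c - c'\<bar>)\<^sup>2"
      by (metis abs_ge_zero power2_abs power_mono)
    also have "\<dots> \<le> (a - a')\<^sup>2 + (c - c')\<^sup>2" by (simp add: max_def)
    finally show ?thesis .
  qed
  have "(\<Sum>u\<in>W. \<Sum>w\<in>W. b u w * (max (\<phi> u) (\<psi> u) - max (\<phi> w) (\<psi> w))\<^sup>2)
      \<le> (\<Sum>u\<in>W. \<Sum>w\<in>W. b u w * (\<phi> u - \<phi> w)\<^sup>2 + b u w * (\<psi> u - \<psi> w)\<^sup>2)"
    using W b by (intro sum_mono) (metis distrib_left mult_left_mono sq subsetD)
  also have "\<dots> \<le> d + e"
    using 1 2 W unfolding energy_le_def by (simp add: sum.distrib add_mono)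
  finally show "(\<Sum>u\<in>W. \<Sum>w\<in>W. b u w * (max (\<phi> u) (\<psi> u) - max (\<phi> w) (\<psi> w))\<^sup>2) \<le> d + e" .
qed

lemma zero_capacity_finite:
  assumes b: "\<And>u w. u \<in> V \<Longrightarrow> w \<in> V \<Longrightarrow> 0 \<le> b u w"
    and F: "finite F" and x: "\<And>x. x \<in> F \<Longrightarrow> zero_capacity V b {x}"
  shows "zero_capacity V b F"
  using F x
proof (induction F)
  case empty
  show ?case unfolding zero_capacity_def energy_le_def
    by (intro allI impI exI[of _ "\<lambda>_. 0"]) auto
next
  case (insert x F)
  show ?case unfolding zero_capacity_def
  proof (intro allI impI)
    fix e :: real assume "e > 0"
    then have e: "e / 2 > 0" by simp
    have "zero_capacity V b F" "zero_capacity V b {x}" using insert by auto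
    then obtain \<phi> where
      p: "finite {v. \<phi> v \<noteq> 0}" "{v. \<phi> v \<noteq> 0} \<subseteq> V" "\<forall>v. 0 \<le> \<phi> v \<and> \<phi> v \<le> 1"
         "\<forall>x\<in>F. \<phi> x = 1" "energy_le V b \<phi> (e/2)"
      unfolding zero_capacity_def using e by blast
    from \<open>zero_capacity V b {x}\<close> obtain \<psi> where
      q: "finite {v. \<psi> v \<noteq> 0}" "{v. \<psi> v \<noteq> 0} \<subseteq> V" "\<forall>v. 0 \<le> \<psi> v \<and> \<psi> v \<le> 1"
         "\<forall>x\<in>{x}. \<psi> x = 1" "energy_le V b \<psi> (e/2)"
      unfolding zero_capacity_def using e by blast
    let ?m = "\<lambda>v. max (\<phi> v) (\<psi> v)"
    have sub: "{v. ?m v \<noteq> 0} \<subseteq> {v. \<phi> v \<noteq> 0} \<union> {v. \<psi> v \<noteq> 0}" by (auto simp: max_def)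
    have "finite {v. ?m v \<noteq> 0}" using sub p(1) q(1) by (meson finite_UnI finite_subset)
    moreover have "{v. ?m v \<noteq> 0} \<subseteq> V" using sub p(2) q(2) by blast
    moreover have "energy_le V b ?m e"
      using energy_le_max[OF b p(5) q(5)] by simp
    moreover have "\<forall>v. 0 \<le> ?m v \<and> ?m v \<le> 1" using p(3) q(3) by (simp add: le_max_iff_disj)
    moreover have "\<forall>y\<in>insert x F. ?m y = 1"
    proof
      fix y assume "y \<in> insert x F"
      then have "\<phi> y = 1 \<or> \<psi> y = 1" using p(4) q(4) by auto
      then show "?m y = 1" using p(3)[rule_format, of y] q(3)[rule_format, of y] by auto
    qed
    ultimately show "\<exists>\<phi>. finite {v. \<phi> v \<noteq> 0} \<and> {v. \<phi> v \<noteq> 0} \<subseteq> V \<and>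
        (\<forall>v. 0 \<le> \<phi> v \<and> \<phi> v \<le> 1) \<and> (\<forall>x\<in>insert x F. \<phi> x = 1) \<and> energy_le V b \<phi> e"
      by (intro exI[of _ ?m] conjI)
  qed
qed

text \<open>Lets each connected component be treated on its own.\<close>

lemma zero_capacity_superset:
  assumes C: "C \<subseteq> V" and x: "zero_capacity C b F"
    and no: "\<And>u w. u \<in> C \<Longrightarrow> w \<in> V - C \<Longrightarrow> b u w = 0 \<and> b w u = 0"
  shows "zero_capacity V b F"
  unfolding zero_capacity_def
proof (intro allI impI)
  fix e :: real assume "e > 0"
  with x obtain \<phi> where p: "finite {v. \<phi> v \<noteq> 0}" "{v. \<phi> v \<noteq> 0} \<subseteq> C" "\<forall>v. 0 \<le> \<phi> v \<and> \<phi> v \<le> 1"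
      "\<forall>x\<in>F. \<phi> x = 1" "energy_le C b \<phi> e"
    unfolding zero_capacity_def by blast
  have "energy_le V b \<phi> e" unfolding energy_le_def
  proof (intro allI impI)
    fix W assume W: "finite W" "W \<subseteq> V"
    have z: "b u w * (\<phi> u - \<phi> w)\<^sup>2 = 0" if "u \<in> W" "w \<in> W" "\<not> (u \<in> C \<and> w \<in> C)" for u w
    proof (cases "u \<in> C \<or> w \<in> C")
      case True
      then show ?thesis using that no W by auto
    next
      case False
      then have "\<phi> u = 0" "\<phi> w = 0" using p(2) by auto
      then show ?thesis by simp
    qed
    have "(\<Sum>w\<in>W. b u w * (\<phi> u - \<phi> w)\<^sup>2) = 0" if "u \<in> W - W \<inter> C" for u
      using that by (intro sum.neutral ballI z) auto
    then have "(\<Sum>u\<in>W. \<Sum>w\<in>W. b u w * (\<phi> u - \<phi> w)\<^sup>2)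
        = (\<Sum>u\<in>W \<inter> C. \<Sum>w\<in>W. b u w * (\<phi> u - \<phi> w)\<^sup>2)"
      using W by (intro sum.mono_neutral_right) auto
    also have "\<dots> = (\<Sum>u\<in>W \<inter> C. \<Sum>w\<in>W \<inter> C. b u w * (\<phi> u - \<phi> w)\<^sup>2)"
      using W z by (intro sum.cong refl sum.mono_neutral_right) auto
    also have "\<dots> \<le> e" using p(5) W unfolding energy_le_def by auto
    finally show "(\<Sum>u\<in>W. \<Sum>w\<in>W. b u w * (\<phi> u - \<phi> w)\<^sup>2) \<le> e" .
  qed
  then show "\<exists>\<phi>. finite {v. \<phi> v \<noteq> 0} \<and> {v. \<phi> v \<noteq> 0} \<subseteq> V \<and>
        (\<forall>v. 0 \<le> \<phi> v \<and> \<phi> v \<le> 1) \<and> (\<forall>x\<in>F. \<phi> x = 1) \<and> energy_le V b \<phi> e"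
    using p C by blast
qed

section \<open>Hitting probabilities inside a finite set\<close>

text \<open>The probability that the chain with transition probabilities \<open>p\<close>, started in \<open>y\<close>, visits \<open>x\<close>
  at some time \<open>k \<le> n\<close> while staying in \<open>A\<close> up to time \<open>k\<close>, computed by conditioning on the first step
  (for \<open>x \<in> A\<close>). Killing the chain outside a finite set \<open>A\<close> keeps the supports and all sums
  finite.\<close>

fun hit_prob :: "'v set \<Rightarrow> ('v \<Rightarrow> 'v \<Rightarrow> real) \<Rightarrow> 'v \<Rightarrow> nat \<Rightarrow> 'v \<Rightarrow> real" where
  "hit_prob A p x 0 y = (if y = x then 1 else 0)"
| "hit_prob A p x (Suc n) y =
     (if y = x then 1 else if y \<in> A then \<Sum>z\<in>A. p y z * hit_prob A p x n z else 0)"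

lemma hit_prob_self [simp]: "hit_prob A p x n x = 1"
  by (cases n) auto

lemma hit_prob_outside: "x \<in> A \<Longrightarrow> y \<notin> A \<Longrightarrow> hit_prob A p x n y = 0"
  by (cases n) auto

lemma hit_prob_nonneg:
  assumes "\<And>u w. u \<in> A \<Longrightarrow> w \<in> A \<Longrightarrow> 0 \<le> p u w"
  shows "0 \<le> hit_prob A p x n y"
  by (induction n arbitrary: y) (auto intro!: sum_nonneg mult_nonneg_nonneg assms)

lemma hit_prob_le_1:
  assumes "\<And>u w. u \<in> A \<Longrightarrow> w \<in> A \<Longrightarrow> 0 \<le> p u w" and "\<And>u. u \<in> A \<Longrightarrow> (\<Sum>w\<in>A. p u w) \<le> 1"
  shows "hit_prob A p x n y \<le> 1"
proof (induction n arbitrary: y)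
  case (Suc n)
  have "(\<Sum>z\<in>A. p y z * hit_prob A p x n z) \<le> 1" if "y \<in> A"
  proof -
    have "(\<Sum>z\<in>A. p y z * hit_prob A p x n z) \<le> (\<Sum>z\<in>A. p y z)"
      using Suc assms(1) that by (intro sum_mono mult_left_le) auto
    then show ?thesis using assms(2)[OF that] by simp
  qed
  then show ?case by simp
qed simp

lemma hit_prob_mono:
  assumes "\<And>u w. u \<in> A \<Longrightarrow> w \<in> A \<Longrightarrow> 0 \<le> p u w"
  shows "hit_prob A p x n y \<le> hit_prob A p x (Suc n) y"
proof (induction n arbitrary: y)
  case 0
  then show ?case by (auto intro!: sum_nonneg mult_nonneg_nonneg assms)
next
  case (Suc n)
  have "(\<Sum>z\<in>A. p y z * hit_prob A p x n z) \<le> (\<Sum>z\<in>A. p y z * hit_prob A p x (Suc n) z)"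
    if "y \<in> A"
    using Suc assms that by (intro sum_mono mult_left_mono) auto
  then show ?case by simp
qed

text \<open>Let \<open>f\<close> be the hitting probability and \<open>D\<close> the degree. Summation by parts turns the energy
  into \<open>2 \<Sum>\<^sub>u D(u) f(u) (f(u) - Pf(u))\<close>. For \<open>u \<noteq> x\<close> in \<open>A\<close> the value \<open>Pf(u)\<close> is the hitting probability with
  one more step allowed, so that term is nonpositive; only \<open>u = x\<close> remains, where \<open>f(x) = 1\<close> and \<open>Pf(x)\<close>
  is the probability of a return.\<close>

lemma energy_hit_prob:
  fixes V :: "'v set" and b :: "'v \<Rightarrow> 'v \<Rightarrow> real"
  defines "p \<equiv> \<lambda>u w. b u w / (\<Sum>\<^sub>\<infinity>z\<in>V. b u z)"
  assumes b: "\<And>u w. u \<in> V \<Longrightarrow> w \<in> V \<Longrightarrow> 0 \<le> b u w"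
    and sym: "\<And>u w. u \<in> V \<Longrightarrow> w \<in> V \<Longrightarrow> b u w = b w u"
    and row: "\<And>u. u \<in> V \<Longrightarrow> b u summable_on V"
    and A: "finite A" "A \<subseteq> V" "x \<in> A"
  shows "energy_le V b (hit_prob A p x n)
    (2 * (\<Sum>\<^sub>\<infinity>z\<in>V. b x z) * (1 - (\<Sum>z\<in>A. p x z * hit_prob A p x n z)))"
  unfolding energy_le_def
proof (intro allI impI)
  fix W assume W: "finite W" "W \<subseteq> V"
  define D where "D = (\<lambda>u. \<Sum>\<^sub>\<infinity>z\<in>V. b u z)"
  define f where "f = hit_prob A p x n"
  \<comment> \<open>Enlarging the window to contain the support lets the sum over \<open>w\<close> of \<open>b u w * f w\<close> be the full one.\<close>
  define U where "U = W \<union> A"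
  have U: "finite U" "U \<subseteq> V" "A \<subseteq> U" using W A by (auto simp: U_def)
  have D: "sum (b u) B \<le> D u" if "u \<in> V" "finite B" "B \<subseteq> V" for u B
    unfolding D_def using that b row by (intro finite_sum_le_infsum) auto
  have D0: "0 \<le> D u" if "u \<in> V" for u using D[OF that, of "{}"] by simp
  \<comment> \<open>If the degree vanishes, so do all weights at \<open>u\<close>, and the default value of the division is harmless.\<close>
  have Dp: "D u * p u w = b u w" if "u \<in> V" "w \<in> V" for u w
  proof (cases "D u = 0")
    case True
    then have "b u w = 0" using D[of u "{w}"] b that by force
    then show ?thesis using True by simp
  qed (simp add: p_def D_def)
  have p0: "0 \<le> p u w" if "u \<in> A" "w \<in> A" for u w
    using that A b[of u w] D0[of u] by (auto simp: p_def D_def intro!: divide_nonneg_nonneg)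
  have f0: "0 \<le> f u" for u unfolding f_def using p0 by (rule hit_prob_nonneg)
  have out: "f u = 0" if "u \<notin> A" for u using hit_prob_outside A that by (simp add: f_def)
  have t0: "0 \<le> b u w * (f u - f w)\<^sup>2" if "u \<in> U" "w \<in> U" for u w
    using b[of u w] that U by (intro mult_nonneg_nonneg) auto
  have WU: "W \<subseteq> U" by (simp add: U_def)
  have "(\<Sum>u\<in>W. \<Sum>w\<in>W. b u w * (f u - f w)\<^sup>2) \<le> (\<Sum>u\<in>W. \<Sum>w\<in>U. b u w * (f u - f w)\<^sup>2)"
  proof (rule sum_mono)
    fix u assume "u \<in> W"
    then show "(\<Sum>w\<in>W. b u w * (f u - f w)\<^sup>2) \<le> (\<Sum>w\<in>U. b u w * (f u - f w)\<^sup>2)"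
      using WU t0 by (intro sum_mono2[OF U(1) WU]) blast
  qed
  also have "\<dots> \<le> (\<Sum>u\<in>U. \<Sum>w\<in>U. b u w * (f u - f w)\<^sup>2)"
    using t0 by (intro sum_mono2[OF U(1) WU] sum_nonneg) blast
  also have "\<dots> = (\<Sum>u\<in>U. \<Sum>w\<in>U. b u w * (f u)\<^sup>2 + b u w * (f w)\<^sup>2 - 2 * (b u w * (f u * f w)))"
    by (intro sum.cong refl) (simp add: power2_eq_square algebra_simps)
  also have "\<dots> = (\<Sum>u\<in>U. \<Sum>w\<in>U. b u w * (f u)\<^sup>2) + (\<Sum>u\<in>U. \<Sum>w\<in>U. b u w * (f w)\<^sup>2)
      - 2 * (\<Sum>u\<in>U. \<Sum>w\<in>U. b u w * (f u * f w))"
    by (simp add: sum.distrib sum_subtractf flip: sum_distrib_left)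
  also have "(\<Sum>u\<in>U. \<Sum>w\<in>U. b u w * (f w)\<^sup>2) = (\<Sum>u\<in>U. \<Sum>w\<in>U. b u w * (f u)\<^sup>2)"
    by (subst sum.swap, intro sum.cong refl) (use U sym in \<open>metis subsetD\<close>)
  also have "(\<Sum>u\<in>U. \<Sum>w\<in>U. b u w * (f u)\<^sup>2) = (\<Sum>u\<in>U. f u * ((\<Sum>w\<in>U. b u w) * f u))"
    by (simp add: power2_eq_square mult_ac flip: sum_distrib_left sum_distrib_right)
  also have "(\<Sum>u\<in>U. \<Sum>w\<in>U. b u w * (f u * f w)) = (\<Sum>u\<in>U. f u * (\<Sum>w\<in>U. b u w * f w))"
    by (simp only: sum_distrib_left mult.left_commute)
  also have "(\<Sum>u\<in>U. f u * ((\<Sum>w\<in>U. b u w) * f u)) + (\<Sum>u\<in>U. f u * ((\<Sum>w\<in>U. b u w) * f u))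
      - 2 * (\<Sum>u\<in>U. f u * (\<Sum>w\<in>U. b u w * f w))
      = 2 * (\<Sum>u\<in>U. f u * ((\<Sum>w\<in>U. b u w) * f u - (\<Sum>w\<in>U. b u w * f w)))"
    by (simp add: right_diff_distrib sum_subtractf)
  also have "(\<Sum>u\<in>U. f u * ((\<Sum>w\<in>U. b u w) * f u - (\<Sum>w\<in>U. b u w * f w)))
      \<le> (\<Sum>u\<in>U. if u = x then D x * (1 - (\<Sum>z\<in>A. p x z * f z)) else 0)"
  proof (rule sum_mono)
    fix u assume u: "u \<in> U"
    show "f u * ((\<Sum>w\<in>U. b u w) * f u - (\<Sum>w\<in>U. b u w * f w))
        \<le> (if u = x then D x * (1 - (\<Sum>z\<in>A. p x z * f z)) else 0)"
    proof (cases "u \<in> A")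
      case True
      have "(\<Sum>w\<in>U. b u w * f w) = (\<Sum>w\<in>A. b u w * f w)"
        using U out by (intro sum.mono_neutral_right) auto
      also have "\<dots> = D u * (\<Sum>w\<in>A. p u w * f w)"
        unfolding sum_distrib_left mult.assoc[symmetric] using Dp[of u] True A
        by (intro sum.cong refl) (metis subsetD)
      finally have "f u * ((\<Sum>w\<in>U. b u w) * f u - (\<Sum>w\<in>U. b u w * f w))
          \<le> f u * (D u * f u - D u * (\<Sum>w\<in>A. p u w * f w))"
        using D[OF subsetD[OF U(2) u] U(1,2)] f0
        by (auto intro!: mult_left_mono mult_right_mono)
      also have "\<dots> = f u * D u * (f u - (\<Sum>w\<in>A. p u w * f w))"
        by (simp add: algebra_simps)
      finally have *: "f u * ((\<Sum>w\<in>U. b u w) * f u - (\<Sum>w\<in>U. b u w * f w)) \<le> \<dots>" .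
      show ?thesis
      proof (cases "u = x")
        case True
        then show ?thesis using * by (simp add: f_def)
      next
        case False
        have "f u \<le> (\<Sum>w\<in>A. p u w * f w)"
          using hit_prob_mono[of A p x n u, OF p0] False True by (simp add: f_def)
        then have "f u * D u * (f u - (\<Sum>w\<in>A. p u w * f w)) \<le> 0"
          using f0 D0[of u] U u by (intro mult_nonneg_nonpos mult_nonneg_nonneg) auto
        then show ?thesis using * False by simp
      qed
    next
      case False
      then show ?thesis using A out by auto
    qed
  qed
  also have "\<dots> = D x * (1 - (\<Sum>z\<in>A. p x z * f z))"
    using U A by (subst sum.delta) auto
  finally show "(\<Sum>u\<in>W. \<Sum>w\<in>W. b u w * (hit_prob A p x n u - hit_prob A p x n w)\<^sup>2)
      \<le> 2 * (\<Sum>\<^sub>\<infinity>z\<in>V. b x z) * (1 - (\<Sum>z\<in>A. p x z * hit_prob A p x n z))"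
    by (simp add: f_def D_def)
qed

section \<open>Recurrence\<close>

lemma markov_chain_pred:
  assumes "markov_chain M Y V p x0"
  shows "Measurable.pred M (\<lambda>\<omega>. P (Y n \<omega>))"
proof -
  have "Y n \<in> measurable M (count_space V)" using assms by (simp add: markov_chain_def)
  from measurable_compose[OF this, of P "count_space UNIV"] show ?thesis by simp
qed

lemma markov_chain_prefix_step:
  assumes mc: "markov_chain M Y V p x0" and s: "\<And>j. j \<le> i \<Longrightarrow> s j \<in> V" and z: "z \<in> V"
  shows "measure M {\<omega> \<in> space M. \<forall>j\<le>Suc i. Y j \<omega> = (s(Suc i := z)) j}
       = measure M {\<omega> \<in> space M. \<forall>j\<le>i. Y j \<omega> = s j} * p (s i) z"
proof -
  have *: "measure M {\<omega> \<in> space M. \<forall>j\<le>n. Y j \<omega> = t j}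
      = (if t 0 = x0 then 1 else 0) * (\<Prod>j<n. p (t j) (t (Suc j)))" if "\<forall>j\<le>n. t j \<in> V" for n t
    using mc that unfolding markov_chain_def by blast
  have 1: "measure M {\<omega> \<in> space M. \<forall>j\<le>Suc i. Y j \<omega> = (s(Suc i := z)) j}
     = (if (s(Suc i := z)) 0 = x0 then 1 else 0)
        * (\<Prod>j<Suc i. p ((s(Suc i := z)) j) ((s(Suc i := z)) (Suc j)))"
    using s z by (intro *) (auto simp: le_Suc_eq)
  have 2: "measure M {\<omega> \<in> space M. \<forall>j\<le>i. Y j \<omega> = s j}
     = (if s 0 = x0 then 1 else 0) * (\<Prod>j<i. p (s j) (s (Suc j)))"
    using s by (intro *) auto
  have "(\<Prod>j<i. p ((s(Suc i := z)) j) ((s(Suc i := z)) (Suc j))) = (\<Prod>j<i. p (s j) (s (Suc j)))"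
    by (rule prod.cong) auto
  then show ?thesis unfolding 1 2 by simp
qed

text \<open>The Markov property for the hitting event, by induction on the number of steps: either the
  path is already at \<open>x\<close>, or the event splits according to the next state \<open>z \<in> A\<close>, which extends the
  prescribed initial piece of the path by one step. Subadditivity is enough, as only an upper bound
  is needed.\<close>

lemma markov_chain_hit_le:
  assumes mc: "markov_chain M Y V p x0" and A: "finite A" "A \<subseteq> V"
    and s: "\<And>j. j \<le> i \<Longrightarrow> s j \<in> V"
  shows "measure M {\<omega> \<in> space M. (\<forall>j\<le>i. Y j \<omega> = s j) \<and>
            (\<exists>k\<le>n. Y (i + k) \<omega> = x \<and> (\<forall>j\<le>k. Y (i + j) \<omega> \<in> A))}
       \<le> measure M {\<omega> \<in> space M. \<forall>j\<le>i. Y j \<omega> = s j} * hit_prob A p x n (s i)"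
  using s
proof (induction n arbitrary: i s)
  case (0 i s)
  interpret prob_space M using mc by (simp add: markov_chain_def)
  note [measurable] = markov_chain_pred[OF mc]
  show ?case
  proof (cases "s i = x")
    case True
    then show ?thesis by (auto intro!: finite_measure_mono)
  next
    case False
    then have "{\<omega> \<in> space M. (\<forall>j\<le>i. Y j \<omega> = s j) \<and>
            (\<exists>k\<le>0. Y (i + k) \<omega> = x \<and> (\<forall>j\<le>k. Y (i + j) \<omega> \<in> A))} = {}" by auto
    then show ?thesis by (simp only: measure_empty) simp
  qed
next
  case (Suc n i s)
  interpret prob_space M using mc by (simp add: markov_chain_def)
  note [measurable] = markov_chain_pred[OF mc]
  let ?E = "\<lambda>n i s. {\<omega> \<in> space M. (\<forall>j\<le>i. Y j \<omega> = s j) \<and>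
            (\<exists>k\<le>n. Y (i + k) \<omega> = x \<and> (\<forall>j\<le>k. Y (i + j) \<omega> \<in> A))}"
  let ?P = "\<lambda>i s. {\<omega> \<in> space M. \<forall>j\<le>i. Y j \<omega> = s j}"
  consider "s i = x" | "s i \<noteq> x" "s i \<notin> A" | "s i \<noteq> x" "s i \<in> A" by blast
  then show ?case
  proof cases
    case 1
    then show ?thesis by (auto intro!: finite_measure_mono)
  next
    case 2
    then have "?E (Suc n) i s = {}" by force
    then show ?thesis using 2 by (simp only: measure_empty) simp
  next
    case 3
    have sub: "?E (Suc n) i s \<subseteq> (\<Union>z\<in>A. ?E n (Suc i) (s(Suc i := z)))"
    proof
      fix \<omega> assume "\<omega> \<in> ?E (Suc n) i s"
      then obtain k where w: "\<omega> \<in> space M" "\<forall>j\<le>i. Y j \<omega> = s j" and k: "k \<le> Suc n"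
        "Y (i + k) \<omega> = x" "\<forall>j\<le>k. Y (i + j) \<omega> \<in> A" by blast
      have "k \<noteq> 0" using k(2) w(2) 3 by (metis add.right_neutral order_refl)
      then obtain k' where k': "k = Suc k'" by (cases k) auto
      have "Y (Suc i) \<omega> \<in> A" using k(3) k' by (metis One_nat_def Suc_le_mono add_Suc_right add.right_neutral le0)
      moreover have "\<omega> \<in> ?E n (Suc i) (s(Suc i := Y (Suc i) \<omega>))"
      proof -
        have "Y (Suc i + j) \<omega> \<in> A" if "j \<le> k'" for j
          using k(3)[rule_format, of "Suc j"] k' that by simp
        then show ?thesis using w k(1,2) k' by (auto simp: le_Suc_eq intro!: exI[of _ k'])
      qed
      ultimately show "\<omega> \<in> (\<Union>z\<in>A. ?E n (Suc i) (s(Suc i := z)))" by blast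
    qed
    have "measure M (?E (Suc n) i s) \<le> measure M (\<Union>z\<in>A. ?E n (Suc i) (s(Suc i := z)))"
      using A by (intro finite_measure_mono sub sets.finite_UN) auto
    also have "\<dots> \<le> (\<Sum>z\<in>A. measure M (?E n (Suc i) (s(Suc i := z))))"
      using A by (intro finite_measure_subadditive_finite) auto
    also have "\<dots> \<le> (\<Sum>z\<in>A. measure M (?P (Suc i) (s(Suc i := z)))
        * hit_prob A p x n ((s(Suc i := z)) (Suc i)))"
      using Suc.prems A by (intro sum_mono Suc.IH) (auto simp: le_Suc_eq)
    also have "\<dots> = (\<Sum>z\<in>A. measure M (?P i s) * p (s i) z * hit_prob A p x n z)"
    proof (rule sum.cong[OF refl])
      fix z assume "z \<in> A"
      then have "z \<in> V" using A by auto
      from markov_chain_prefix_step[OF mc Suc.prems this, of i]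
      show "measure M (?P (Suc i) (s(Suc i := z))) * hit_prob A p x n ((s(Suc i := z)) (Suc i))
          = measure M (?P i s) * p (s i) z * hit_prob A p x n z" by simp
    qed
    also have "\<dots> = measure M (?P i s) * hit_prob A p x (Suc n) (s i)"
      using 3 by (simp add: sum_distrib_left mult.assoc)
    finally show ?thesis .
  qed
qed

text \<open>Exhaust the countable state space by finite sets \<open>A\<^sub>N\<close> and let \<open>E\<^sub>N\<close> be the event of a return
  at one of the times \<open>1, \<dots>, N + 1\<close> with the path up to then inside \<open>A\<^sub>N\<close>. A returning path visits finitely
  many states before its return, so these events increase to the event of a return, which has
  probability \<open>1\<close>; continuity of the measure gives a suitable \<open>N\<close>.\<close>

lemma recurrent_return_prob:
  assumes mc: "markov_chain M Y V p x" and V: "countable V" "x \<in> V"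
    and ret: "measure M {\<omega> \<in> space M. \<exists>k>0. Y k \<omega> = x} = 1" and e: "e > (0::real)"
  shows "\<exists>A n. finite A \<and> A \<subseteq> V \<and> x \<in> A \<and> 1 - e < (\<Sum>z\<in>A. p x z * hit_prob A p x n z)"
proof -
  interpret prob_space M using mc by (simp add: markov_chain_def)
  note [measurable] = markov_chain_pred[OF mc]
  have YV: "Y k \<omega> \<in> V" if "\<omega> \<in> space M" for k \<omega>
    using mc that unfolding markov_chain_def by (metis measurable_space space_count_space)
  define A where "A = (\<lambda>N. from_nat_into V ` {..N} \<union> {x})"
  have A: "finite (A N)" "A N \<subseteq> V" "x \<in> A N" for N
    using V by (auto simp: A_def intro: from_nat_into)
  have Amono: "A N \<subseteq> A N'" if "N \<le> N'" for N N' using that by (auto simp: A_def)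
  define E where "E = (\<lambda>N. {\<omega> \<in> space M. Y 0 \<omega> = x \<and>
     (\<exists>k\<le>N. Y (Suc k) \<omega> = x \<and> (\<forall>j\<le>k. Y (Suc j) \<omega> \<in> A N))})"
  have Em: "E N \<in> sets M" for N unfolding E_def by measurable
  have "incseq E"
  proof (rule incseq_SucI)
    fix N
    have "A N \<subseteq> A (Suc N)" by (rule Amono) simp
    then show "E N \<subseteq> E (Suc N)" unfolding E_def by (auto intro: le_SucI)
  qed
  moreover have "range E \<subseteq> events" using Em by auto
  ultimately have lim: "(\<lambda>N. prob (E N)) \<longlonglongrightarrow> prob (\<Union>N. E N)"
    by (intro finite_Lim_measure_incseq)
  have U: "(\<Union>N. E N) = {\<omega> \<in> space M. Y 0 \<omega> = x \<and> (\<exists>k>0. Y k \<omega> = x)}" (is "_ = ?R")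
  proof
    show "(\<Union>N. E N) \<subseteq> ?R" unfolding E_def by auto
    show "?R \<subseteq> (\<Union>N. E N)"
    proof
      fix \<omega> assume "\<omega> \<in> ?R"
      then obtain k where w: "\<omega> \<in> space M" "Y 0 \<omega> = x" "Y (Suc k) \<omega> = x"
        using gr0_implies_Suc by blast
      define g where "g = (\<lambda>j. to_nat_on V (Y (Suc j) \<omega>))"
      \<comment> \<open>Any number dominating \<open>k\<close> and all the indices \<open>g 0, \<dots>, g k\<close> will do.\<close>
      define N where "N = k + (\<Sum>j\<le>k. g j)"
      have "Y (Suc j) \<omega> \<in> A N" if "j \<le> k" for j
      proof -
        have "g j \<le> (\<Sum>j\<le>k. g j)" using that by (intro member_le_sum) auto
        then have "g j \<le> N" by (simp add: N_def)
        moreover have "from_nat_into V (g j) = Y (Suc j) \<omega>"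
          using V YV[OF w(1)] by (simp add: g_def)
        ultimately show ?thesis unfolding A_def by (metis UnI1 atMost_iff image_eqI)
      qed
      then have "\<omega> \<in> E N" using w by (auto simp: E_def N_def intro!: exI[of _ k])
      then show "\<omega> \<in> (\<Union>N. E N)" by blast
    qed
  qed
  have "\<forall>n s. (\<forall>i\<le>n. s i \<in> V) \<longrightarrow> prob {\<omega> \<in> space M. \<forall>i\<le>n. Y i \<omega> = s i} =
      (if s 0 = x then 1 else 0) * (\<Prod>i<n. p (s i) (s (Suc i)))"
    using mc unfolding markov_chain_def by blast
  from this[rule_format, of 0 "\<lambda>_. x"] have start: "prob {\<omega> \<in> space M. Y 0 \<omega> = x} = 1"
    using V by simp
  have "prob ?R = 1"
  proof -
    have "AE \<omega> in M. \<exists>k>0. Y k \<omega> = x" using ret by (subst (asm) prob_Collect_eq_1) auto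
    moreover have "AE \<omega> in M. Y 0 \<omega> = x" using start by (subst (asm) prob_Collect_eq_1) auto
    ultimately have "AE \<omega> in M. Y 0 \<omega> = x \<and> (\<exists>k>0. Y k \<omega> = x)" by auto
    then show ?thesis by (subst prob_Collect_eq_1) auto
  qed
  then have "(\<lambda>N. prob (E N)) \<longlonglongrightarrow> 1" using lim U by simp
  then have "eventually (\<lambda>N. 1 - e < prob (E N)) sequentially"
    using e by (intro order_tendstoD) auto
  then obtain N where N: "1 - e < prob (E N)" by (auto simp: eventually_sequentially)
  let ?s = "\<lambda>z. (\<lambda>_. x)(Suc 0 := z)"
  let ?F = "\<lambda>z. {\<omega> \<in> space M. (\<forall>j\<le>Suc 0. Y j \<omega> = ?s z j) \<and>
            (\<exists>k\<le>N. Y (Suc 0 + k) \<omega> = x \<and> (\<forall>j\<le>k. Y (Suc 0 + j) \<omega> \<in> A N))}"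
  have sub: "E N \<subseteq> (\<Union>z\<in>A N. ?F z)"
  proof
    fix \<omega> assume w: "\<omega> \<in> E N"
    then have "Y (Suc 0) \<omega> \<in> A N" by (auto simp: E_def)
    moreover have "\<omega> \<in> ?F (Y (Suc 0) \<omega>)" using w by (auto simp: E_def le_Suc_eq)
    ultimately show "\<omega> \<in> (\<Union>z\<in>A N. ?F z)" by blast
  qed
  have "prob (E N) \<le> prob (\<Union>z\<in>A N. ?F z)"
    using A by (intro finite_measure_mono sub sets.finite_UN) auto
  also have "\<dots> \<le> (\<Sum>z\<in>A N. prob (?F z))"
    using A by (intro finite_measure_subadditive_finite) auto
  also have "\<dots> \<le> (\<Sum>z\<in>A N. p x z * hit_prob (A N) p x N z)"
  proof (rule sum_mono)
    fix z assume "z \<in> A N"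
    then have z: "z \<in> V" using A by auto
    have "prob (?F z) \<le> prob {\<omega> \<in> space M. \<forall>j\<le>Suc 0. Y j \<omega> = ?s z j}
        * hit_prob (A N) p x N (?s z (Suc 0))"
      using V z by (intro markov_chain_hit_le[OF mc A(1,2)]) auto
    also have "prob {\<omega> \<in> space M. \<forall>j\<le>Suc 0. Y j \<omega> = ?s z j} = p x z"
      using markov_chain_prefix_step[OF mc _ z, of 0 "\<lambda>_. x"] V start by simp
    finally show "prob (?F z) \<le> p x z * hit_prob (A N) p x N z" by simp
  qed
  finally show ?thesis using N A by (intro exI[of _ "A N"] exI[of _ N]) auto
qed

lemma recurrent_graph_zero_capacity:
  fixes b :: "'v \<Rightarrow> 'v \<Rightarrow> real"
  assumes b: "\<And>u w. u \<in> V \<Longrightarrow> w \<in> V \<Longrightarrow> 0 \<le> b u w"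
    and sym: "\<And>u w. u \<in> V \<Longrightarrow> w \<in> V \<Longrightarrow> b u w = b w u"
    and row: "\<And>u. u \<in> V \<Longrightarrow> b u summable_on V"
    and V: "countable V" "x \<in> V" and rec: "recurrent_graph V b"
  shows "zero_capacity V b {x}"
  unfolding zero_capacity_def
proof (intro allI impI)
  fix e :: real assume e: "e > 0"
  define D where "D = (\<lambda>u. \<Sum>\<^sub>\<infinity>z\<in>V. b u z)"
  define p where "p = (\<lambda>u w. b u w / (\<Sum>\<^sub>\<infinity>z\<in>V. b u z))"
  have D0: "0 \<le> D u" if "u \<in> V" for u unfolding D_def using b that by (intro infsum_nonneg) auto
  obtain M :: "(nat \<Rightarrow> 'v) measure" where M: "markov_chain M (\<lambda>k \<omega>. \<omega> k) V p x"
      "measure M {\<omega> \<in> space M. \<exists>k>0. \<omega> k = x} = 1"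
    using rec V unfolding recurrent_graph_def p_def by blast
  \<comment> \<open>The summand \<open>1\<close> covers a vertex of degree zero.\<close>
  have "e / (2 * D x + 1) > 0" using e D0[OF V(2)] by (simp add: divide_pos_pos)
  from recurrent_return_prob[OF M(1) V M(2) this] obtain A n where
    A: "finite A" "A \<subseteq> V" "x \<in> A" and
    h: "1 - e / (2 * D x + 1) < (\<Sum>z\<in>A. p x z * hit_prob A p x n z)" by blast
  let ?f = "hit_prob A p x n"
  have p0: "0 \<le> p u w" if "u \<in> A" "w \<in> A" for u w
    using that A b[of u w] D0[of u] by (auto simp: p_def D_def intro!: divide_nonneg_nonneg)
  have p1: "(\<Sum>w\<in>A. p u w) \<le> 1" if "u \<in> A" for u
  proof -
    have "sum (b u) A \<le> D u"
      unfolding D_def using that b row A by (intro finite_sum_le_infsum) auto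
    then have "sum (b u) A / D u \<le> 1"
      using D0[of u] that A by (auto simp: divide_le_eq_1)
    then show ?thesis by (simp add: p_def D_def sum_divide_distrib)
  qed
  have supp: "{v. ?f v \<noteq> 0} \<subseteq> A" using hit_prob_outside[OF A(3)] by auto
  have "2 * D x * (1 - (\<Sum>z\<in>A. p x z * ?f z)) \<le> 2 * D x * (e / (2 * D x + 1))"
    using h D0[OF V(2)] by (intro mult_left_mono) auto
  also have "\<dots> \<le> e" using e D0[OF V(2)] by (simp add: field_simps)
  finally have "energy_le V b ?f e"
    using energy_hit_prob[OF b sym row A, of n] energy_le_mono
    unfolding p_def D_def by blast
  moreover have "finite {v. ?f v \<noteq> 0}" "{v. ?f v \<noteq> 0} \<subseteq> V"
    using supp A by (auto intro: finite_subset)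
  moreover have "\<forall>v. 0 \<le> ?f v \<and> ?f v \<le> 1"
    using hit_prob_nonneg[of A p] hit_prob_le_1[of A p] p0 p1 by blast
  ultimately show "\<exists>\<phi>. finite {v. \<phi> v \<noteq> 0} \<and> {v. \<phi> v \<noteq> 0} \<subseteq> V \<and>
        (\<forall>v. 0 \<le> \<phi> v \<and> \<phi> v \<le> 1) \<and> (\<forall>x\<in>{x}. \<phi> x = 1) \<and> energy_le V b \<phi> e"
    by (intro exI[of _ ?f]) simp
qed

text \<open>There are no edges between different components, so test functions on the component of \<open>x\<close>
  are test functions on the whole graph with the same energy. On a component with a single vertex the
  indicator has energy zero, because loops do not contribute.\<close>

lemma recurrent_components_zero_capacity:
  fixes b :: "'v \<Rightarrow> 'v \<Rightarrow> real"
  assumes b: "\<And>u w. u \<in> V \<Longrightarrow> w \<in> V \<Longrightarrow> 0 \<le> b u w"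
    and sym: "\<And>u w. u \<in> V \<Longrightarrow> w \<in> V \<Longrightarrow> b u w = b w u"
    and row: "\<And>u. u \<in> V \<Longrightarrow> b u summable_on V"
    and V: "countable V" "x \<in> V"
    and rec: "\<And>C. C \<in> graph_components V b \<Longrightarrow> recurrent_component C b"
  shows "zero_capacity V b {x}"
proof -
  define E where "E = (\<lambda>u w. u \<in> V \<and> w \<in> V \<and> b u w > 0)"
  define C where "C = {w \<in> V. E\<^sup>*\<^sup>* x w}"
  have xC: "x \<in> C" "C \<subseteq> V" using V by (auto simp: C_def)
  have C: "C = {(u, w). u \<in> V \<and> w \<in> V \<and> E\<^sup>*\<^sup>* u w} `` {x}" using V by (auto simp: C_def)
  have "graph_components V b = V // {(u, w). u \<in> V \<and> w \<in> V \<and> E\<^sup>*\<^sup>* u w}"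
    by (simp add: graph_components_def E_def)
  then have "C \<in> graph_components V b"
    using quotientI[OF V(2)] by (simp only: C)
  then have rc: "recurrent_component C b" by (rule rec)
  have no: "b u w = 0 \<and> b w u = 0" if "u \<in> C" "w \<in> V - C" for u w
  proof -
    have uw: "u \<in> V" "w \<in> V" using that xC by auto
    have "\<not> E u w"
    proof
      assume "E u w"
      with that(1) have "E\<^sup>*\<^sup>* x w" unfolding C_def by (auto elim: rtranclp.rtrancl_into_rtrancl)
      with that(2) show False by (simp add: C_def)
    qed
    then have "b u w = 0" using b[OF uw] uw by (simp add: E_def)
    then show ?thesis using sym[OF uw] by simp
  qed
  have "zero_capacity C b {x}"
  proof (cases "is_singleton C")
    case True
    then have C: "C = {x}" using xC by (auto simp: is_singleton_def)
    have "energy_le C b (indicator {x}) e" if "e > 0" for e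
      unfolding energy_le_def
    proof (intro allI impI)
      fix W assume "finite W" "W \<subseteq> C"
      then have "W = {} \<or> W = {x}" using C by auto
      then show "(\<Sum>u\<in>W. \<Sum>w\<in>W. b u w * (indicator {x} u - indicator {x} w)\<^sup>2) \<le> e"
        using that by auto
    qed
    then show ?thesis unfolding zero_capacity_def using C
      by (intro allI impI exI[of _ "indicator {x}"]) (auto simp: indicator_def)
  next
    case False
    then have "recurrent_graph C b" using rc by (simp add: recurrent_component_def)
    show ?thesis
    proof (rule recurrent_graph_zero_capacity)
      show "countable C" using V xC by (blast intro: countable_subset)
      show "b u summable_on C" if "u \<in> C" for u
        using summable_on_subset_banach[OF row xC(2)] that xC by blast
      show "recurrent_graph C b" by fact
      show "0 \<le> b u w" "b u w = b w u" if "u \<in> C" "w \<in> C" for u w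
        using b sym that xC by blast+
    qed (rule xC)
  qed
  then show ?thesis using zero_capacity_superset[OF xC(2), of b "{x}"] no by blast
qed

section \<open>Simplices around a fixed simplex\<close>

text \<open>Faces are only inherited when nonempty: the empty simplex may have been removed.\<close>

lemma simplicesD:
  assumes "weighted_simplicial_complex X K m" "S = simplices X K m" "\<sigma> \<in> S"
  shows "finite \<sigma>" "\<sigma> \<subseteq> X" "0 < m \<sigma>" "m summable_on {\<sigma>' \<in> S. face \<sigma> \<sigma>'}"
    "\<And>\<tau>. \<tau> \<subseteq> \<sigma> \<Longrightarrow> \<tau> \<noteq> {} \<Longrightarrow> \<tau> \<in> S"
proof -
  have K: "\<sigma> \<in> K" using assms(2,3) by (auto simp: simplices_def split: if_splits)
  show "finite \<sigma>" "\<sigma> \<subseteq> X" "0 < m \<sigma>" "m summable_on {\<sigma>' \<in> S. face \<sigma> \<sigma>'}"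
    using assms K by (auto simp: weighted_simplicial_complex_def simplicial_complex_def)
  fix \<tau> assume "\<tau> \<subseteq> \<sigma>" "\<tau> \<noteq> {}"
  moreover from this have "\<tau> \<in> K"
    using assms(1) K unfolding weighted_simplicial_complex_def simplicial_complex_def by blast
  ultimately show "\<tau> \<in> S" using assms(2) by (auto simp: simplices_def)
qed

lemma face_iff: "face \<tau> \<sigma> \<longleftrightarrow> (\<exists>v. v \<notin> \<tau> \<and> \<sigma> = {v} \<union> \<tau>)"
proof
  assume f: "face \<tau> \<sigma>"
  then obtain v where "\<sigma> - \<tau> = {v}" by (auto simp: face_def card_1_singleton_iff)
  then show "\<exists>v. v \<notin> \<tau> \<and> \<sigma> = {v} \<union> \<tau>" using f by (auto simp: face_def)
next
  assume "\<exists>v. v \<notin> \<tau> \<and> \<sigma> = {v} \<union> \<tau>"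
  then obtain v where v: "v \<notin> \<tau>" "\<sigma> = {v} \<union> \<tau>" by blast
  then have "\<sigma> - \<tau> = {v}" by auto
  then show "face \<tau> \<sigma>" using v by (auto simp: face_def)
qed

lemma link_iff:
  assumes "weighted_simplicial_complex X K m" "S = simplices X K m"
  shows "v \<in> link X S \<rho> \<longleftrightarrow> {v} \<union> \<rho> \<in> S \<and> v \<notin> \<rho>"
proof -
  have "face \<rho> ({v} \<union> \<rho>) \<longleftrightarrow> v \<notin> \<rho>"
    unfolding face_def by (cases "v \<in> \<rho>") (auto simp: insert_Diff_if)
  moreover have "{v} \<union> \<rho> \<in> S \<Longrightarrow> v \<in> X" using simplicesD(2)[OF assms] by blast
  ultimately show ?thesis by (auto simp: link_def)
qed

text \<open>The edges at \<open>v\<close> correspond to cofaces of \<open>v\<rho>\<close>, so this is local summability at \<open>v\<rho>\<close>.\<close>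

lemma link_graph_summable:
  assumes W: "weighted_simplicial_complex X K m" "S = simplices X K m" and v: "v \<in> link X S \<rho>"
  shows "link_graph S m \<rho> v summable_on link X S \<rho>"
proof -
  let ?h = "\<lambda>w. {v} \<union> {w} \<union> \<rho>"
  let ?V = "{w \<in> link X S \<rho>. v \<noteq> w \<and> ?h w \<in> S}"
  have v': "{v} \<union> \<rho> \<in> S" using v by (simp add: link_iff[OF W])
  have inj: "inj_on ?h ?V" by (rule inj_onI) (auto simp: link_iff[OF W])
  have "?h ` ?V \<subseteq> {\<sigma> \<in> S. face ({v} \<union> \<rho>) \<sigma>}"
    by (auto simp: link_iff[OF W] face_iff)
  then have "m summable_on ?h ` ?V"
    using simplicesD(4)[OF W v'] summable_on_subset_banach by blast
  then have "(m \<circ> ?h) summable_on ?V" using summable_on_reindex[OF inj] by blast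
  then show ?thesis
    by (rule summable_on_cong_neutral[THEN iffD1, rotated -1]) (auto simp: link_graph_def)
qed

text \<open>A summable family of positive weights is countable, and \<open>v\<close> is determined by the coface \<open>v\<rho>\<close>.\<close>

lemma countable_link:
  assumes W: "weighted_simplicial_complex X K m" "S = simplices X K m" and \<rho>: "\<rho> \<in> S"
  shows "countable (link X S \<rho>)"
proof (rule countable_image_inj_on)
  let ?T = "{\<sigma> \<in> S. face \<rho> \<sigma>}"
  have "countable {\<sigma> \<in> ?T. m \<sigma> \<noteq> 0}"
    by (rule summable_countable_real) (rule simplicesD(4)[OF W \<rho>])
  moreover have "{\<sigma> \<in> ?T. m \<sigma> \<noteq> 0} = ?T" using simplicesD(3)[OF W] by force
  ultimately have "countable ?T" by simp
  moreover have "(\<lambda>v. {v} \<union> \<rho>) ` link X S \<rho> \<subseteq> ?T" by (auto simp: link_def)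
  ultimately show "countable ((\<lambda>v. {v} \<union> \<rho>) ` link X S \<rho>)" by (rule countable_subset[rotated])
  show "inj_on (\<lambda>v. {v} \<union> \<rho>) (link X S \<rho>)"
    by (rule inj_onI) (auto simp: link_iff[OF W])
qed

lemma link_zero_capacity:
  assumes W: "weighted_simplicial_complex X K m" "S = simplices X K m" and \<rho>: "\<rho> \<in> S"
    and rec: "\<And>C. C \<in> graph_components (link X S \<rho>) (link_graph S m \<rho>)
           \<Longrightarrow> recurrent_component C (link_graph S m \<rho>)"
    and F: "finite F" "F \<subseteq> link X S \<rho>"
  shows "zero_capacity (link X S \<rho>) (link_graph S m \<rho>) F"
proof (rule zero_capacity_finite[OF _ F(1)])
  have nn: "0 \<le> link_graph S m \<rho> u w" for u w
    using simplicesD(3)[OF W] by (auto simp: link_graph_def less_imp_le)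
  then show "0 \<le> link_graph S m \<rho> u w" for u w .
  fix x assume "x \<in> F"
  then have x: "x \<in> link X S \<rho>" using F by blast
  have sym: "link_graph S m \<rho> u w = link_graph S m \<rho> w u" for u w
    unfolding link_graph_def by (simp only: Un_commute[of "{u}"] eq_commute[of u w])
  show "zero_capacity (link X S \<rho>) (link_graph S m \<rho>) {x}"
    by (rule recurrent_components_zero_capacity[OF nn sym link_graph_summable[OF W]
          countable_link[OF W \<rho>] x rec])
qed

section \<open>Truncating the coboundary of a simplex\<close>

lemma sqnorm_le:
  assumes "\<And>\<tau>. \<tau> \<in> S \<Longrightarrow> 0 \<le> m \<tau>"
    and "\<And>F. finite F \<Longrightarrow> F \<subseteq> S \<Longrightarrow> (\<Sum>\<tau>\<in>F. m \<tau> * (cmod (f \<tau>))\<^sup>2) \<le> e"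
  shows "sqnorm S m f \<le> ennreal e"
  unfolding sqnorm_def
proof (rule infsum_le_finite_sums)
  fix F assume F: "finite F" "F \<subseteq> S"
  have "0 \<le> m \<tau> * (cmod (f \<tau>))\<^sup>2" if "\<tau> \<in> F" for \<tau>
    using assms(1)[of \<tau>] F that by (intro mult_nonneg_nonneg) auto
  then have "(\<Sum>\<tau>\<in>F. ennreal (m \<tau> * (cmod (f \<tau>))\<^sup>2)) = ennreal (\<Sum>\<tau>\<in>F. m \<tau> * (cmod (f \<tau>))\<^sup>2)"
    by (rule sum_ennreal)
  also have "\<dots> \<le> ennreal e" using assms(2)[OF F] by (rule ennreal_leI)
  finally show "(\<Sum>\<tau>\<in>F. ennreal (m \<tau> * (cmod (f \<tau>))\<^sup>2)) \<le> ennreal e" .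
qed (simp add: nonneg_summable_on_complete)

lemma indicator_fun_space: "\<rho> \<in> S \<Longrightarrow> indicator {\<rho>} \<in> fun_space S"
  by (auto simp: fun_space_def indicator_def)

lemma coboundary_fun_space:
  assumes "coboundary_operator S \<delta>" "\<omega> \<in> fun_space S"
  shows "\<delta> \<omega> \<in> fun_space S"
proof -
  have "\<delta> \<omega> = (\<lambda>\<sigma>. if \<sigma> \<in> S
      then (\<Sum>\<tau> | \<tau> \<in> S \<and> face \<tau> \<sigma>. \<delta> (indicator {\<tau>}) \<sigma> * \<omega> \<tau>) else 0)"
    using assms unfolding coboundary_operator_def by blast
  then show ?thesis by (simp add: fun_space_def)
qed

lemma coboundary_apply:
  assumes "coboundary_operator S \<delta>" "\<omega> \<in> fun_space S" "\<sigma> \<in> S"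
  shows "\<delta> \<omega> \<sigma> = (\<Sum>\<tau> | \<tau> \<in> S \<and> face \<tau> \<sigma>. \<delta> (indicator {\<tau>}) \<sigma> * \<omega> \<tau>)"
proof -
  have "\<delta> \<omega> = (\<lambda>\<sigma>. if \<sigma> \<in> S
      then (\<Sum>\<tau> | \<tau> \<in> S \<and> face \<tau> \<sigma>. \<delta> (indicator {\<tau>}) \<sigma> * \<omega> \<tau>) else 0)"
    using assms unfolding coboundary_operator_def by blast
  from fun_cong[OF this, of \<sigma>] show ?thesis using assms(3) by simp
qed

lemma coboundary_diff:
  assumes \<delta>: "coboundary_operator S \<delta>" and f: "f \<in> fun_space S" "g \<in> fun_space S"
  shows "\<delta> (\<lambda>\<tau>. f \<tau> - g \<tau>) = (\<lambda>\<sigma>. \<delta> f \<sigma> - \<delta> g \<sigma>)"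
proof
  fix \<sigma>
  have d: "(\<lambda>\<tau>. f \<tau> - g \<tau>) \<in> fun_space S" using f by (simp add: fun_space_def)
  show "\<delta> (\<lambda>\<tau>. f \<tau> - g \<tau>) \<sigma> = \<delta> f \<sigma> - \<delta> g \<sigma>"
  proof (cases "\<sigma> \<in> S")
    case True
    then show ?thesis
      unfolding coboundary_apply[OF \<delta> d True] coboundary_apply[OF \<delta> f(1) True]
        coboundary_apply[OF \<delta> f(2) True]
      by (simp add: right_diff_distrib sum_subtractf)
  next
    case False
    then show ?thesis
      using coboundary_fun_space[OF \<delta> d] coboundary_fun_space[OF \<delta> f(1)]
        coboundary_fun_space[OF \<delta> f(2)] by (simp add: fun_space_def)
  qed
qed

lemma coboundary_indicator_zero:
  assumes \<delta>: "coboundary_operator S \<delta>" and \<rho>: "\<rho> \<in> S" and n: "\<not> (\<sigma> \<in> S \<and> face \<rho> \<sigma>)"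
  shows "\<delta> (indicator {\<rho>}) \<sigma> = 0"
proof -
  have i: "indicator {\<rho>} \<in> fun_space S" using \<rho> by (rule indicator_fun_space)
  show ?thesis
  proof (cases "\<sigma> \<in> S")
    case True
    then show ?thesis unfolding coboundary_apply[OF \<delta> i True]
      using n by (intro sum.neutral) (auto simp: indicator_def)
  next
    case False
    then show ?thesis using coboundary_fun_space[OF \<delta> i] by (simp add: fun_space_def)
  qed
qed

text \<open>The vertex \<open>v\<close> is recovered from the coface \<open>\<tau> = v\<rho>\<close> as the element of \<open>\<tau> - \<rho>\<close>; off the cofaces
  of \<open>\<rho>\<close> the junk value of \<open>the_elem\<close> is multiplied by \<open>0\<close>. For any function supported on the cofaces of
  \<open>\<rho>\<close>, its coboundary at \<open>vw\<rho>\<close> has just the two terms coming from \<open>v\<rho>\<close> and \<open>w\<rho>\<close>. Applied to \<open>\<delta>1\<^sub>\<rho>\<close>, whose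
  coboundary is zero, this shows that the two signs cancel; applied to \<open>\<omega>\<close> it gives the
  difference of the values of \<open>\<phi>\<close>.\<close>

lemma coboundary_truncation:
  fixes \<phi> :: "'a \<Rightarrow> real"
  assumes W: "weighted_simplicial_complex X K m" "S = simplices X K m"
    and \<delta>: "coboundary_operator S \<delta>" and \<rho>: "\<rho> \<in> S" and \<sigma>: "\<sigma> \<in> S"
  defines "\<omega> \<equiv> (\<lambda>\<tau>. of_real (\<phi> (the_elem (\<tau> - \<rho>))) * \<delta> (indicator {\<rho>}) \<tau>)"
  assumes nz: "\<delta> \<omega> \<sigma> \<noteq> 0"
  shows "\<exists>v w. v \<in> link X S \<rho> \<and> w \<in> link X S \<rho> \<and> v \<noteq> w \<and> \<sigma> = {v} \<union> {w} \<union> \<rho> \<and>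
    cmod (\<delta> \<omega> \<sigma>) = \<bar>\<phi> v - \<phi> w\<bar>"
proof -
  let ?\<eta> = "\<delta> (indicator {\<rho>})"
  have i: "indicator {\<rho>} \<in> fun_space S" using \<rho> by (rule indicator_fun_space)
  have \<eta>: "?\<eta> \<in> fun_space S" by (rule coboundary_fun_space[OF \<delta> i])
  then have \<omega>: "\<omega> \<in> fun_space S" by (simp add: fun_space_def \<omega>_def)
  have \<eta>0: "?\<eta> \<tau> = 0" if "\<not> face \<rho> \<tau>" for \<tau>
    using coboundary_indicator_zero[OF \<delta> \<rho>] that by blast
  obtain \<tau> where \<tau>: "\<tau> \<in> S" "face \<tau> \<sigma>" "face \<rho> \<tau>"
  proof -
    have "(\<Sum>\<tau> | \<tau> \<in> S \<and> face \<tau> \<sigma>. \<delta> (indicator {\<tau>}) \<sigma> * \<omega> \<tau>) \<noteq> 0"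
      using nz coboundary_apply[OF \<delta> \<omega> \<sigma>] by simp
    then obtain \<tau> where "\<tau> \<in> S" "face \<tau> \<sigma>" "\<omega> \<tau> \<noteq> 0"
      by (metis (mono_tags, lifting) mem_Collect_eq mult_zero_right sum.not_neutral_contains_not_neutral)
    then show ?thesis using that[of \<tau>] \<eta>0[of \<tau>] by (auto simp: \<omega>_def)
  qed
  obtain v where v: "v \<notin> \<rho>" "\<tau> = {v} \<union> \<rho>" using \<tau>(3) face_iff by metis
  obtain w where w: "w \<notin> \<tau>" "\<sigma> = {w} \<union> \<tau>" using \<tau>(2) face_iff by metis
  have vw: "v \<noteq> w" "w \<notin> \<rho>" "\<sigma> = {v} \<union> {w} \<union> \<rho>" using v w by auto
  let ?v = "{v} \<union> \<rho>" and ?w = "{w} \<union> \<rho>"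
  have inS: "?v \<in> S" "?w \<in> S" using simplicesD(5)[OF W \<sigma>, of ?v] simplicesD(5)[OF W \<sigma>, of ?w] vw(3)
    by auto
  have faces: "face ?v \<sigma>" "face ?w \<sigma>" "face \<rho> ?v" "face \<rho> ?w"
    unfolding face_iff using v w by auto
  have expand: "\<delta> f \<sigma> = \<delta> (indicator {?v}) \<sigma> * f ?v + \<delta> (indicator {?w}) \<sigma> * f ?w"
    if f: "f \<in> fun_space S" "\<And>\<tau>. \<not> face \<rho> \<tau> \<Longrightarrow> f \<tau> = 0" for f
  proof -
    have "\<delta> f \<sigma> = (\<Sum>\<tau> | \<tau> \<in> S \<and> face \<tau> \<sigma>. \<delta> (indicator {\<tau>}) \<sigma> * f \<tau>)"
      by (rule coboundary_apply[OF \<delta> f(1) \<sigma>])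
    also have "\<dots> = (\<Sum>\<tau>\<in>{?v, ?w}. \<delta> (indicator {\<tau>}) \<sigma> * f \<tau>)"
    proof (rule sum.mono_neutral_right)
      have "{\<tau>. \<tau> \<in> S \<and> face \<tau> \<sigma>} \<subseteq> Pow \<sigma>" by (auto simp: face_def)
      then show "finite {\<tau>. \<tau> \<in> S \<and> face \<tau> \<sigma>}"
        using simplicesD(1)[OF W \<sigma>] by (meson finite_Pow_iff finite_subset)
      show "{?v, ?w} \<subseteq> {\<tau>. \<tau> \<in> S \<and> face \<tau> \<sigma>}" using inS faces by simp
      have "\<tau> \<in> {?v, ?w}" if t: "face \<tau> \<sigma>" "face \<rho> \<tau>" for \<tau>
      proof -
        obtain u where u: "u \<notin> \<rho>" "\<tau> = {u} \<union> \<rho>" using t(2) face_iff by metis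
        have "\<tau> \<subseteq> \<sigma>" using t(1) by (simp add: face_def)
        then have "u = v \<or> u = w" using u vw by auto
        then show ?thesis using u by auto
      qed
      then show "\<forall>\<tau>\<in>{\<tau>. \<tau> \<in> S \<and> face \<tau> \<sigma>} - {?v, ?w}. \<delta> (indicator {\<tau>}) \<sigma> * f \<tau> = 0"
        using f(2) by (metis (mono_tags, lifting) DiffE mem_Collect_eq mult_zero_right)
    qed
    also have "\<dots> = \<delta> (indicator {?v}) \<sigma> * f ?v + \<delta> (indicator {?w}) \<sigma> * f ?w"
    proof -
      have "?v \<noteq> ?w" using v vw by auto
      then show ?thesis by simp
    qed
    finally show ?thesis .
  qed
  have "\<delta> ?\<eta> \<sigma> = 0" using \<delta> i unfolding coboundary_operator_def by metis
  then have z: "\<delta> (indicator {?v}) \<sigma> * ?\<eta> ?v + \<delta> (indicator {?w}) \<sigma> * ?\<eta> ?w = 0"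
    using expand[OF \<eta> \<eta>0] by simp
  have sgn: "\<forall>\<sigma>\<in>S. \<forall>\<tau>\<in>S. face \<tau> \<sigma> \<longrightarrow> \<delta> (indicator {\<tau>}) \<sigma> \<in> {1, -1}"
    using \<delta> unfolding coboundary_operator_def by blast
  have n: "cmod (\<delta> (indicator {?v}) \<sigma>) = 1" "cmod (?\<eta> ?v) = 1"
    using sgn[rule_format, OF \<sigma> inS(1) faces(1)] sgn[rule_format, OF inS(1) \<rho> faces(3)] by auto
  have "?v - \<rho> = {v}" "?w - \<rho> = {w}" using v vw by auto
  then have te: "\<omega> ?v = of_real (\<phi> v) * ?\<eta> ?v" "\<omega> ?w = of_real (\<phi> w) * ?\<eta> ?w"
    unfolding \<omega>_def by simp_all
  have "\<delta> \<omega> \<sigma> = \<delta> (indicator {?v}) \<sigma> * \<omega> ?v + \<delta> (indicator {?w}) \<sigma> * \<omega> ?w"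
    using \<omega> \<eta>0 by (intro expand) (simp_all add: \<omega>_def)
  also have "\<dots> = of_real (\<phi> v) * (\<delta> (indicator {?v}) \<sigma> * ?\<eta> ?v)
      + of_real (\<phi> w) * (\<delta> (indicator {?w}) \<sigma> * ?\<eta> ?w)"
    unfolding te by (simp add: mult_ac)
  also have "\<delta> (indicator {?w}) \<sigma> * ?\<eta> ?w = - (\<delta> (indicator {?v}) \<sigma> * ?\<eta> ?v)"
    using z by (simp add: eq_neg_iff_add_eq_0 add.commute)
  also have "of_real (\<phi> v) * (\<delta> (indicator {?v}) \<sigma> * ?\<eta> ?v)
      + of_real (\<phi> w) * (- (\<delta> (indicator {?v}) \<sigma> * ?\<eta> ?v))
      = of_real (\<phi> v - \<phi> w) * (\<delta> (indicator {?v}) \<sigma> * ?\<eta> ?v)"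
    by (simp add: left_diff_distrib)
  finally have "cmod (\<delta> \<omega> \<sigma>) = \<bar>\<phi> v - \<phi> w\<bar>"
    using n by (simp only: norm_mult norm_of_real) simp
  moreover have "v \<in> link X S \<rho>" "w \<in> link X S \<rho>"
    using inS v vw by (auto simp: link_iff[OF W])
  ultimately show ?thesis using vw by blast
qed

text \<open>Choosing for each simplex \<open>vw\<rho>\<close> one of the two orderings of \<open>v, w\<close> maps the simplices
  injectively to ordered pairs of vertices of the link, on which the energy is a sum.\<close>

lemma sqnorm_coboundary_truncation:
  fixes \<phi> :: "'a \<Rightarrow> real"
  assumes W: "weighted_simplicial_complex X K m" "S = simplices X K m"
    and \<delta>: "coboundary_operator S \<delta>" and \<rho>: "\<rho> \<in> S"
    and en: "energy_le (link X S \<rho>) (link_graph S m \<rho>) \<phi> e"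
  shows "sqnorm S m (\<delta> (\<lambda>\<tau>. of_real (\<phi> (the_elem (\<tau> - \<rho>))) * \<delta> (indicator {\<rho>}) \<tau>)) \<le> ennreal e"
proof (rule sqnorm_le)
  show "0 \<le> m \<tau>" if "\<tau> \<in> S" for \<tau> using simplicesD(3)[OF W that] by simp
  let ?g = "\<delta> (\<lambda>\<tau>. of_real (\<phi> (the_elem (\<tau> - \<rho>))) * \<delta> (indicator {\<rho>}) \<tau>)"
  let ?b = "link_graph S m \<rho>"
  fix F assume F: "finite F" "F \<subseteq> S"
  define F' where "F' = {\<sigma> \<in> F. ?g \<sigma> \<noteq> 0}"
  have "\<forall>\<sigma>\<in>F'. \<exists>q. fst q \<in> link X S \<rho> \<and> snd q \<in> link X S \<rho> \<and> fst q \<noteq> snd q \<and>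
      \<sigma> = {fst q} \<union> {snd q} \<union> \<rho> \<and> cmod (?g \<sigma>) = \<bar>\<phi> (fst q) - \<phi> (snd q)\<bar>"
  proof
    fix \<sigma> assume "\<sigma> \<in> F'"
    then have "\<sigma> \<in> S" "?g \<sigma> \<noteq> 0" using F by (auto simp: F'_def)
    from coboundary_truncation[OF W \<delta> \<rho> this] show "\<exists>q. fst q \<in> link X S \<rho> \<and>
      snd q \<in> link X S \<rho> \<and> fst q \<noteq> snd q \<and>
      \<sigma> = {fst q} \<union> {snd q} \<union> \<rho> \<and> cmod (?g \<sigma>) = \<bar>\<phi> (fst q) - \<phi> (snd q)\<bar>" by force
  qed
  from bchoice[OF this] obtain q where q: "\<And>\<sigma>. \<sigma> \<in> F' \<Longrightarrow> fst (q \<sigma>) \<in> link X S \<rho>"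
    "\<And>\<sigma>. \<sigma> \<in> F' \<Longrightarrow> snd (q \<sigma>) \<in> link X S \<rho>" "\<And>\<sigma>. \<sigma> \<in> F' \<Longrightarrow> fst (q \<sigma>) \<noteq> snd (q \<sigma>)"
    "\<And>\<sigma>. \<sigma> \<in> F' \<Longrightarrow> \<sigma> = {fst (q \<sigma>)} \<union> {snd (q \<sigma>)} \<union> \<rho>"
    "\<And>\<sigma>. \<sigma> \<in> F' \<Longrightarrow> cmod (?g \<sigma>) = \<bar>\<phi> (fst (q \<sigma>)) - \<phi> (snd (q \<sigma>))\<bar>" by blast
  define U where "U = fst ` q ` F' \<union> snd ` q ` F'"
  have U: "finite U" "U \<subseteq> link X S \<rho>" using F q by (auto simp: U_def F'_def)
  have inj: "inj_on q F'" by (rule inj_onI) (metis q(4))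
  let ?t = "\<lambda>(u, w). ?b u w * (\<phi> u - \<phi> w)\<^sup>2"
  have "(\<Sum>\<sigma>\<in>F. m \<sigma> * (cmod (?g \<sigma>))\<^sup>2) = (\<Sum>\<sigma>\<in>F'. m \<sigma> * (cmod (?g \<sigma>))\<^sup>2)"
    using F by (intro sum.mono_neutral_right) (auto simp: F'_def)
  also have "\<dots> = (\<Sum>\<sigma>\<in>F'. ?t (q \<sigma>))"
  proof (rule sum.cong[OF refl])
    fix \<sigma> assume s: "\<sigma> \<in> F'"
    then have "\<sigma> \<in> S" using F by (auto simp: F'_def)
    then have "?b (fst (q \<sigma>)) (snd (q \<sigma>)) = m \<sigma>"
      using q(3)[OF s] q(4)[OF s] unfolding link_graph_def by metis
    then show "m \<sigma> * (cmod (?g \<sigma>))\<^sup>2 = ?t (q \<sigma>)"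
      using q(5)[OF s] by (simp add: case_prod_unfold)
  qed
  also have "\<dots> = sum ?t (q ` F')" using inj by (simp add: sum.reindex)
  also have "\<dots> \<le> sum ?t (U \<times> U)"
  proof (rule sum_mono2)
    show "finite (U \<times> U)" using U by simp
    show "q ` F' \<subseteq> U \<times> U"
    proof
      fix y assume "y \<in> q ` F'"
      then have "fst y \<in> U" "snd y \<in> U" by (auto simp only: U_def)
      then show "y \<in> U \<times> U" by (simp add: mem_Times_iff)
    qed
    fix x assume "x \<in> U \<times> U - q ` F'"
    have "0 \<le> ?b u w" for u w
      using simplicesD(3)[OF W] by (auto simp: link_graph_def less_imp_le)
    then show "0 \<le> ?t x" by (simp add: case_prod_unfold)
  qed
  also have "\<dots> = (\<Sum>u\<in>U. \<Sum>w\<in>U. ?b u w * (\<phi> u - \<phi> w)\<^sup>2)"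
    by (simp add: sum.cartesian_product)
  also have "\<dots> \<le> e" using en U unfolding energy_le_def by blast
  finally show "(\<Sum>\<sigma>\<in>F. m \<sigma> * (cmod (?g \<sigma>))\<^sup>2) \<le> e" .
qed

lemma summable_on_tail:
  fixes f :: "'b \<Rightarrow> real"
  assumes f: "f summable_on A" "\<And>x. x \<in> A \<Longrightarrow> 0 \<le> f x" and e: "e > 0"
  obtains G where "finite G" "G \<subseteq> A" "\<And>H. finite H \<Longrightarrow> H \<subseteq> A - G \<Longrightarrow> sum f H \<le> e"
proof -
  have "(sum f \<longlongrightarrow> infsum f A) (finite_subsets_at_top A)"
    using f(1) has_sum_infsum has_sum_def by blast
  then have "eventually (\<lambda>G. infsum f A - e < sum f G) (finite_subsets_at_top A)"
    using e by (intro order_tendstoD) auto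
  then obtain G where G: "finite G" "G \<subseteq> A" "infsum f A - e < sum f G"
    unfolding eventually_finite_subsets_at_top by blast
  show ?thesis
  proof (rule that[OF G(1,2)])
    fix H assume H: "finite H" "H \<subseteq> A - G"
    have "sum f H + sum f G = sum f (H \<union> G)"
      using G H by (intro sum.union_disjoint[symmetric]) auto
    also have "\<dots> \<le> infsum f A"
      using G H f by (intro finite_sum_le_infsum) auto
    finally show "sum f H \<le> e" using G(3) by simp
  qed
qed

text \<open>Choose a finite set \<open>G\<close> of cofaces that carries all but \<open>e\<close> of their mass, and truncate by a
  test function that equals \<open>1\<close> on the vertices of \<open>G\<close>: the error lives on the remaining cofaces and is
  bounded by \<open>1\<close> there.\<close>

lemma coboundary_approximation:
  assumes W: "weighted_simplicial_complex X K m" "S = simplices X K m"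
    and \<delta>: "coboundary_operator S \<delta>" and \<rho>: "\<rho> \<in> S"
    and cap: "\<And>F. finite F \<Longrightarrow> F \<subseteq> link X S \<rho> \<Longrightarrow>
      zero_capacity (link X S \<rho>) (link_graph S m \<rho>) F"
    and e: "e > 0"
  shows "\<exists>\<omega> \<in> fin_supp S. sqnorm S m (\<lambda>\<tau>. \<omega> \<tau> - \<delta> (indicator {\<rho>}) \<tau>) \<le> ennreal e \<and>
     sqnorm S m (\<delta> (\<lambda>\<tau>. \<omega> \<tau> - \<delta> (indicator {\<rho>}) \<tau>)) \<le> ennreal e"
proof -
  let ?\<eta> = "\<delta> (indicator {\<rho>})"
  let ?T = "{\<sigma> \<in> S. face \<rho> \<sigma>}"
  have i: "indicator {\<rho>} \<in> fun_space S" using \<rho> by (rule indicator_fun_space)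
  have \<eta>: "?\<eta> \<in> fun_space S" by (rule coboundary_fun_space[OF \<delta> i])
  have T: "\<exists>v \<in> link X S \<rho>. \<tau> = {v} \<union> \<rho> \<and> the_elem (\<tau> - \<rho>) = v" if "\<tau> \<in> ?T" for \<tau>
  proof -
    obtain v where v: "v \<notin> \<rho>" "\<tau> = {v} \<union> \<rho>" using \<open>\<tau> \<in> ?T\<close> face_iff by (metis mem_Collect_eq)
    then have "\<tau> - \<rho> = {v}" by auto
    then show ?thesis using v that by (auto simp: link_iff[OF W])
  qed
  have "m summable_on ?T" by (rule simplicesD(4)[OF W \<rho>])
  then obtain G where G: "finite G" "G \<subseteq> ?T" "\<And>H. finite H \<Longrightarrow> H \<subseteq> ?T - G \<Longrightarrow> sum m H \<le> e"
    using simplicesD(3)[OF W] e by (elim summable_on_tail) (auto simp: less_imp_le)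
  define F where "F = (\<lambda>\<tau>. the_elem (\<tau> - \<rho>)) ` G"
  have "finite F" "F \<subseteq> link X S \<rho>" using G T by (fastforce simp: F_def)+
  from cap[OF this] e obtain \<phi> where
    p: "finite {v. \<phi> v \<noteq> 0}" "\<And>v. 0 \<le> \<phi> v \<and> \<phi> v \<le> 1" "\<And>x. x \<in> F \<Longrightarrow> \<phi> x = 1"
      "energy_le (link X S \<rho>) (link_graph S m \<rho>) \<phi> e"
    unfolding zero_capacity_def by blast
  define \<omega> where "\<omega> = (\<lambda>\<tau>. of_real (\<phi> (the_elem (\<tau> - \<rho>))) * ?\<eta> \<tau>)"
  have \<eta>0: "?\<eta> \<tau> = 0" if "\<tau> \<notin> ?T" for \<tau>
    using coboundary_indicator_zero[OF \<delta> \<rho>] that by blast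
  have \<eta>1: "cmod (?\<eta> \<tau>) = 1" if "\<tau> \<in> ?T" for \<tau>
  proof -
    have "?\<eta> \<tau> \<in> {1, -1}" using \<delta> \<rho> that unfolding coboundary_operator_def by blast
    then show ?thesis by auto
  qed
  have "\<omega> \<in> fun_space S" using \<eta> by (simp add: fun_space_def \<omega>_def)
  have "{\<tau>. \<omega> \<tau> \<noteq> 0} \<subseteq> (\<lambda>v. {v} \<union> \<rho>) ` {v. \<phi> v \<noteq> 0}"
  proof
    fix \<tau> assume "\<tau> \<in> {\<tau>. \<omega> \<tau> \<noteq> 0}"
    then have nz: "\<phi> (the_elem (\<tau> - \<rho>)) \<noteq> 0" "\<tau> \<in> ?T" using \<eta>0[of \<tau>] by (auto simp: \<omega>_def)
    from T[OF nz(2)] obtain v where "\<tau> = {v} \<union> \<rho>" "the_elem (\<tau> - \<rho>) = v" by blast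
    with nz(1) show "\<tau> \<in> (\<lambda>v. {v} \<union> \<rho>) ` {v. \<phi> v \<noteq> 0}" by (intro image_eqI[of _ _ v]) auto
  qed
  then have "finite {\<tau>. \<omega> \<tau> \<noteq> 0}" using p(1) finite_surj by blast
  then have fs: "\<omega> \<in> fin_supp S" using \<open>\<omega> \<in> fun_space S\<close> by (simp add: fin_supp_def)
  have "\<delta> ?\<eta> = (\<lambda>_. 0)" using \<delta> i unfolding coboundary_operator_def by blast
  then have "\<delta> (\<lambda>\<tau>. \<omega> \<tau> - ?\<eta> \<tau>) = \<delta> \<omega>"
    using coboundary_diff[OF \<delta> \<open>\<omega> \<in> fun_space S\<close> \<eta>] by simp
  then have 2: "sqnorm S m (\<delta> (\<lambda>\<tau>. \<omega> \<tau> - ?\<eta> \<tau>)) \<le> ennreal e"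
    using sqnorm_coboundary_truncation[OF W \<delta> \<rho> p(4)] by (simp add: \<omega>_def)
  have 1: "sqnorm S m (\<lambda>\<tau>. \<omega> \<tau> - ?\<eta> \<tau>) \<le> ennreal e"
  proof (rule sqnorm_le)
    show m0: "0 \<le> m \<tau>" if "\<tau> \<in> S" for \<tau> using simplicesD(3)[OF W that] by simp
    fix B assume B: "finite B" "B \<subseteq> S"
    have z: "\<omega> \<tau> - ?\<eta> \<tau> = 0" if "\<tau> \<notin> ?T - G" for \<tau>
    proof (cases "\<tau> \<in> G")
      case True
      then have "\<phi> (the_elem (\<tau> - \<rho>)) = 1" using p(3) by (simp add: F_def)
      then show ?thesis by (simp add: \<omega>_def)
    next
      case False
      then show ?thesis using \<eta>0[of \<tau>] that by (simp add: \<omega>_def)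
    qed
    have le: "cmod (\<omega> \<tau> - ?\<eta> \<tau>) \<le> 1" if "\<tau> \<in> ?T" for \<tau>
    proof -
      have "\<omega> \<tau> - ?\<eta> \<tau> = of_real (\<phi> (the_elem (\<tau> - \<rho>)) - 1) * ?\<eta> \<tau>"
        by (simp add: \<omega>_def left_diff_distrib)
      then have "cmod (\<omega> \<tau> - ?\<eta> \<tau>) = \<bar>\<phi> (the_elem (\<tau> - \<rho>)) - 1\<bar>"
        using \<eta>1[OF that] by (simp only: norm_mult norm_of_real mult_1_right)
      then show ?thesis using p(2)[of "the_elem (\<tau> - \<rho>)"] by (simp add: abs_le_iff)
    qed
    have "(\<Sum>\<tau>\<in>B. m \<tau> * (cmod (\<omega> \<tau> - ?\<eta> \<tau>))\<^sup>2)
        = (\<Sum>\<tau>\<in>B \<inter> (?T - G). m \<tau> * (cmod (\<omega> \<tau> - ?\<eta> \<tau>))\<^sup>2)"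
    proof (rule sum.mono_neutral_right)
      show "\<forall>\<tau>\<in>B - B \<inter> (?T - G). m \<tau> * (cmod (\<omega> \<tau> - ?\<eta> \<tau>))\<^sup>2 = 0"
      proof
        fix \<tau> assume "\<tau> \<in> B - B \<inter> (?T - G)"
        then have "\<omega> \<tau> - ?\<eta> \<tau> = 0" by (intro z) blast
        then show "m \<tau> * (cmod (\<omega> \<tau> - ?\<eta> \<tau>))\<^sup>2 = 0" by simp
      qed
    qed (use B in auto)
    also have "\<dots> \<le> sum m (B \<inter> (?T - G))"
    proof (rule sum_mono)
      fix \<tau> assume t: "\<tau> \<in> B \<inter> (?T - G)"
      then have "(cmod (\<omega> \<tau> - ?\<eta> \<tau>))\<^sup>2 \<le> 1" using le[of \<tau>] by (auto intro: power_le_one)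
      then show "m \<tau> * (cmod (\<omega> \<tau> - ?\<eta> \<tau>))\<^sup>2 \<le> m \<tau>"
        using m0[of \<tau>] t by (intro mult_left_le) auto
    qed
    also have "\<dots> \<le> e" using B by (intro G(3)) auto
    finally show "(\<Sum>\<tau>\<in>B. m \<tau> * (cmod (\<omega> \<tau> - ?\<eta> \<tau>))\<^sup>2) \<le> e" .
  qed
  show ?thesis using fs 1 2 by blast
qed

lemma coboundary_indicator_ell2:
  assumes W: "weighted_simplicial_complex X K m" "S = simplices X K m"
    and \<delta>: "coboundary_operator S \<delta>" and \<rho>: "\<rho> \<in> S"
  shows "\<delta> (indicator {\<rho>}) \<in> ell2 S m"
proof -
  let ?\<eta> = "\<delta> (indicator {\<rho>})"
  let ?T = "{\<sigma> \<in> S. face \<rho> \<sigma>}"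
  have i: "indicator {\<rho>} \<in> fun_space S" using \<rho> by (rule indicator_fun_space)
  have m0: "0 \<le> m \<tau>" if "\<tau> \<in> S" for \<tau> using simplicesD(3)[OF W that] by simp
  have "sqnorm S m ?\<eta> \<le> ennreal (infsum m ?T)"
  proof (rule sqnorm_le[OF m0])
    fix B assume B: "finite B" "B \<subseteq> S"
    have "(\<Sum>\<tau>\<in>B. m \<tau> * (cmod (?\<eta> \<tau>))\<^sup>2) = (\<Sum>\<tau>\<in>B \<inter> ?T. m \<tau> * (cmod (?\<eta> \<tau>))\<^sup>2)"
      using B coboundary_indicator_zero[OF \<delta> \<rho>] by (intro sum.mono_neutral_right) auto
    also have "\<dots> = sum m (B \<inter> ?T)"
    proof (rule sum.cong[OF refl])
      fix \<tau> assume "\<tau> \<in> B \<inter> ?T"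
      then have "?\<eta> \<tau> \<in> {1, -1}" using \<delta> \<rho> unfolding coboundary_operator_def by blast
      then show "m \<tau> * (cmod (?\<eta> \<tau>))\<^sup>2 = m \<tau>" by auto
    qed
    also have "\<dots> \<le> infsum m ?T"
      using B m0 by (intro finite_sum_le_infsum simplicesD(4)[OF W \<rho>]) auto
    finally show "(\<Sum>\<tau>\<in>B. m \<tau> * (cmod (?\<eta> \<tau>))\<^sup>2) \<le> infsum m ?T" .
  qed
  also have "\<dots> < \<infinity>" by simp
  finally show ?thesis using coboundary_fun_space[OF \<delta> i] by (simp add: ell2_def)
qed

lemma coboundary_indicator_dom:
  assumes W: "weighted_simplicial_complex X K m" "S = simplices X K m"
    and \<delta>: "coboundary_operator S \<delta>" and \<rho>: "\<rho> \<in> S"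
    and rec: "\<And>C. C \<in> graph_components (link X S \<rho>) (link_graph S m \<rho>)
           \<Longrightarrow> recurrent_component C (link_graph S m \<rho>)"
  shows "\<delta> (indicator {\<rho>}) \<in> dom_cobd_D S m \<delta>"
proof -
  let ?\<eta> = "\<delta> (indicator {\<rho>})"
  have "\<exists>\<omega> \<in> fin_supp S. sqnorm S m (\<lambda>\<tau>. \<omega> \<tau> - ?\<eta> \<tau>) \<le> ennreal (inverse (real (Suc n))) \<and>
     sqnorm S m (\<delta> (\<lambda>\<tau>. \<omega> \<tau> - ?\<eta> \<tau>)) \<le> ennreal (inverse (real (Suc n)))" for n
    by (rule coboundary_approximation[OF W \<delta> \<rho> link_zero_capacity[OF W \<rho> rec]]) auto
  then obtain \<omega>n where \<omega>n: "\<And>n. \<omega>n n \<in> fin_supp S"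
    "\<And>n. sqnorm S m (\<lambda>\<tau>. \<omega>n n \<tau> - ?\<eta> \<tau>) \<le> ennreal (inverse (real (Suc n)))"
    "\<And>n. sqnorm S m (\<delta> (\<lambda>\<tau>. \<omega>n n \<tau> - ?\<eta> \<tau>)) \<le> ennreal (inverse (real (Suc n)))"
    by metis
  have "(\<lambda>n. ennreal (inverse (real (Suc n))) + ennreal (inverse (real (Suc n))))
      \<longlonglongrightarrow> ennreal 0 + ennreal 0"
    by (intro tendsto_add tendsto_ennrealI LIMSEQ_inverse_real_of_nat)
  then have "(\<lambda>n. ennreal (inverse (real (Suc n))) + ennreal (inverse (real (Suc n)))) \<longlonglongrightarrow> 0"
    by simp
  then have "(\<lambda>n. sqnorm S m (\<lambda>\<tau>. \<omega>n n \<tau> - ?\<eta> \<tau>) + sqnorm S m (\<delta> (\<lambda>\<tau>. \<omega>n n \<tau> - ?\<eta> \<tau>)))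
      \<longlonglongrightarrow> 0"
  proof (rule tendsto_sandwich[rotated 2, OF tendsto_const])
    show "\<forall>\<^sub>F n in sequentially. sqnorm S m (\<lambda>\<tau>. \<omega>n n \<tau> - ?\<eta> \<tau>)
        + sqnorm S m (\<delta> (\<lambda>\<tau>. \<omega>n n \<tau> - ?\<eta> \<tau>))
        \<le> ennreal (inverse (real (Suc n))) + ennreal (inverse (real (Suc n)))"
      by (intro always_eventually allI add_mono \<omega>n)
  qed simp
  moreover have "\<forall>n. \<omega>n n \<in> fin_supp S" using \<omega>n(1) by blast
  ultimately show ?thesis
    using coboundary_indicator_ell2[OF W \<delta> \<rho>] unfolding dom_cobd_D_def
    by (intro CollectI conjI exI[of _ \<omega>n])
qed

theorem corollary5p4:
  fixes X :: "'a set" and K S :: "'a set set" and m :: "'a set \<Rightarrow> real"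
    and \<delta> :: "('a set \<Rightarrow> complex) \<Rightarrow> ('a set \<Rightarrow> complex)" and \<rho> :: "'a set"
  assumes "weighted_simplicial_complex X K m"
    and "S = simplices X K m"
    and "coboundary_operator S \<delta>"
    and "\<rho> \<in> S"
    and "\<And>C. C \<in> graph_components (link X S \<rho>) (link_graph S m \<rho>)
           \<Longrightarrow> recurrent_component C (link_graph S m \<rho>)"
  shows "cobd_D S m \<delta> (indicator {\<rho>}) \<in> dom_cobd_D S m \<delta> \<and>
    ((\<exists>\<sigma>\<in>S. face \<rho> \<sigma>) \<longrightarrow>
      cobd_D S m \<delta> (indicator {\<rho>}) \<noteq> (\<lambda>_. 0) \<and>
      cobd_D S m \<delta> (indicator {\<rho>}) \<in> dom_up_laplacian_D S m \<delta> \<and>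
      up_laplacian_D S m \<delta> (cobd_D S m \<delta> (indicator {\<rho>})) = (\<lambda>_. 0))"
proof -
  let ?\<eta> = "\<delta> (indicator {\<rho>})"
  have eq: "cobd_D S m \<delta> (indicator {\<rho>}) = ?\<eta>"
    using indicator_in_dom_cobd_D[OF assms(3,4)] by (simp add: cobd_D_def)
  have dom: "?\<eta> \<in> dom_cobd_D S m \<delta>" by (rule coboundary_indicator_dom[OF assms])
  have i: "indicator {\<rho>} \<in> fun_space S" using assms(4) by (rule indicator_fun_space)
  have "\<delta> ?\<eta> = (\<lambda>_. 0)" using assms(3) i unfolding coboundary_operator_def by blast
  then have "cobd_D S m \<delta> ?\<eta> = (\<lambda>_. 0)" using dom by (simp add: cobd_D_def)
  then have rep: "represents_form_D S m \<delta> ?\<eta> (\<lambda>_. 0)"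
    by (simp add: represents_form_D_def form_D_def ell2_inner_def ell2_def fun_space_def sqnorm_def)
  then have lap: "?\<eta> \<in> dom_up_laplacian_D S m \<delta>"
    using dom by (auto simp: dom_up_laplacian_D_def)
  have "(THE \<eta>. represents_form_D S m \<delta> ?\<eta> \<eta>) = (\<lambda>_. 0)"
  proof (rule the_equality)
    show "represents_form_D S m \<delta> ?\<eta> (\<lambda>_. 0)" by (rule rep)
    show "\<eta> = (\<lambda>_. 0)" if "represents_form_D S m \<delta> ?\<eta> \<eta>" for \<eta>
      by (rule represents_form_D_unique[OF assms(3) simplicesD(3)[OF assms(1,2)] that rep])
  qed
  then have "up_laplacian_D S m \<delta> ?\<eta> = (\<lambda>_. 0)" using lap by (simp add: up_laplacian_D_def)
  moreover have "?\<eta> \<noteq> (\<lambda>_. 0)" if coface: "\<exists>\<sigma>\<in>S. face \<rho> \<sigma>"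
  proof -
    obtain \<sigma> where "\<sigma> \<in> S" "face \<rho> \<sigma>" using coface by blast
    then have "?\<eta> \<sigma> \<in> {1, -1}" using assms(3,4) unfolding coboundary_operator_def by blast
    then show ?thesis by auto
  qed
  ultimately show ?thesis unfolding eq using dom lap by blast
qed

end
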